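(* Let $\lambda=(\lambda_1,\lambda_2,\ldots,\lambda_n)$ be a partition with $\lambda_1\ge\lambda_2\ge\cdots\ge\lambda_n$, let $T_\lambda$ be the associated Ferrers graph, $I_\lambda=I_{T_\lambda}$ its toric ideal and $R=\mathbb{K}[E(T_\lambda)]$. If $\lambda_2\ge2$, write $\lambda=(\lambda_1,\ldots,\lambda_s,1,1,\ldots,1)$ with $\lambda_s\ge2$. Then (1) $a(R/I_\lambda)=-(n+m-1)$ if $n=1$ or $\lambda_2=1$, and $$a(R/I_\lambda)=-(n+m-1)+\min\bigl\{s-1,\ \{\lambda_j+j-3 : 2\le j\le s\}\bigr\}$$ otherwise; (2) $$e(R/I_\lambda)=\sum_{j_{n-2}=\lambda_2-\lambda_n+1}^{\lambda_2}\ \sum_{j_{n-3}=\lambda_2-\lambda_{n-1}+1}^{j_{n-2}}\cdots\sum_{j_1=\lambda_2-\lambda_3+1}^{j_2} j_1 .$$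
   Context: $\mathbb{K}$ is an algebraically closed field of characteristic $0$. For a finite simple graph $G$ with vertex set $V$ and edge set $E(G)$ (vertices and edges also naming variables of degree $1$), the toric ideal $I_G\subseteq\mathbb{K}[E(G)]$ is the kernel of the $\mathbb{K}$-algebra homomorphism $\mathbb{K}[E(G)]\to\mathbb{K}[V]$ sending each edge $e=\{u,w\}$ to $uw$. A Ferrers graph is a bipartite graph on vertex classes $X=\{v_1,\ldots,v_n\}$ and $Y=\{u_1,\ldots,u_m\}$ such that $\{v_1,u_m\}$ and $\{v_n,u_1\}$ are edges and, whenever $\{v_i,u_j\}$ is an edge, so are all $\{v_k,u_l\}$ with $1\le k\le i$ and $1\le l\le j$. Its associated partition is $\lambda=(\lambda_1,\ldots,\lambda_n)$ with $\lambda_i=\deg v_i$ (so $\lambda_1=m$ and $\lambda_n\ge1$); the graph is denoted $T_\lambda$. The number $m$ in the claim is $|Y|$. The minimum in (1) is taken over $s-1$ together with all the numbers $\lambda_j+j-3$, $2\le j\le s$. For a graded module $M$ of dimension $\delta$ with Hilbert series $h_M(t)/(1-t)^{\delta}$, where $h_M(t)$ is a polynomial: $a(M)=\deg h_M(t)-\delta$ is the $a$-invariant and $e(M)=h_M(1)$ is the multiplicity. In the iterated sum in (2), the summation indices are $j_{n-2},j_{n-3},\ldots,j_1$; the index $j_k$ starts at $\lambda_2-\lambda_{k+2}+1$ and ends at $j_{k+1}$, except that $j_{n-2}$ ends at $\lambda_2$. *)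

theory Defs
  imports
    "HOL-Algebra.Embedded_Algebras"
    "HOL-Algebra.QuotRing"
    "HOL-Library.Poly_Mapping"
    "HOL-Library.Extended_Nat"
    "HOL-Computational_Algebra.Polynomial_FPS"
begin

section \<open>Polynomial rings\<close>

text \<open>
  Monomials are finitely supported exponent functions, and polynomials are finitely supported
  functions from monomials to the coefficients; the product is the convolution product of
  \<^theory>\<open>HOL-Library.Poly_Mapping\<close>.
\<close>

type_synonym ('x, 'k) mpoly = "('x \<Rightarrow>\<^sub>0 nat) \<Rightarrow>\<^sub>0 'k"

definition mconst :: "'k \<Rightarrow> ('x, 'k::comm_ring_1) mpoly" where
  "mconst c = Poly_Mapping.single 0 c"

definition mvar :: "'x \<Rightarrow> ('x, 'k::comm_ring_1) mpoly" where
  "mvar x = Poly_Mapping.single (Poly_Mapping.single x 1) 1"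

definition mdeg :: "('x \<Rightarrow>\<^sub>0 nat) \<Rightarrow> nat" where
  "mdeg \<mu> = (\<Sum>x\<in>Poly_Mapping.keys \<mu>. Poly_Mapping.lookup \<mu> x)"

definition mpoly_ring :: "'x set \<Rightarrow> ('x, 'k::comm_ring_1) mpoly ring" where
  "mpoly_ring S =
    \<lparr>carrier = {p. \<forall>\<mu>\<in>Poly_Mapping.keys p. Poly_Mapping.keys \<mu> \<subseteq> S},
     monoid.mult = (*), one = 1, zero = 0, add = (+)\<rparr>"

text \<open>Homogeneous component of degree \<open>d\<close>, all variables having degree 1.\<close>

definition homog_part :: "'x set \<Rightarrow> nat \<Rightarrow> ('x, 'k::comm_ring_1) mpoly set" where
  "homog_part S d =
    {p \<in> carrier (mpoly_ring S). \<forall>\<mu>\<in>Poly_Mapping.keys p. mdeg \<mu> = d}"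


section \<open>Toric ideals of graphs\<close>

text \<open>An edge is the two-element set of its endpoints.\<close>

definition simple_graph :: "'v set \<Rightarrow> 'v set set \<Rightarrow> bool" where
  "simple_graph V E \<longleftrightarrow> finite V \<and> (\<forall>e\<in>E. e \<subseteq> V \<and> card e = 2)"

definition vdeg :: "'v set set \<Rightarrow> 'v \<Rightarrow> nat" where
  "vdeg E x = card {e \<in> E. x \<in> e}"

text \<open>
  The algebra homomorphism that sends the variable \<open>e = {u, w}\<close> to the product \<open>uw\<close> of the
  variables of its endpoints.
\<close>

definition edge_hom :: "('v set, 'k::comm_ring_1) mpoly \<Rightarrow> ('v, 'k) mpoly" where
  "edge_hom p =
    (\<Sum>\<mu>\<in>Poly_Mapping.keys p. mconst (Poly_Mapping.lookup p \<mu>) *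
      (\<Prod>e\<in>Poly_Mapping.keys \<mu>. (\<Prod>x\<in>e. mvar x) ^ Poly_Mapping.lookup \<mu> e))"

definition toric_ideal :: "'v set \<Rightarrow> 'v set set \<Rightarrow> ('v set, 'k::comm_ring_1) mpoly set" where
  "toric_ideal V E = a_kernel (mpoly_ring E) (mpoly_ring V) edge_hom"


section \<open>Ferrers graphs\<close>

definition ferrers_graph ::
  "'v set \<Rightarrow> 'v set set \<Rightarrow> nat \<Rightarrow> nat \<Rightarrow> (nat \<Rightarrow> 'v) \<Rightarrow> (nat \<Rightarrow> 'v) \<Rightarrow> bool" where
  "ferrers_graph V E n m v u \<longleftrightarrow>
     simple_graph V E \<and> 1 \<le> n \<and> 1 \<le> m \<and>
     inj_on v {1..n} \<and> inj_on u {1..m} \<and>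
     v ` {1..n} \<inter> u ` {1..m} = {} \<and> V = v ` {1..n} \<union> u ` {1..m} \<and>
     (\<forall>e\<in>E. \<exists>i\<in>{1..n}. \<exists>j\<in>{1..m}. e = {v i, u j}) \<and>
     {v 1, u m} \<in> E \<and> {v n, u 1} \<in> E \<and>
     (\<forall>i\<in>{1..n}. \<forall>j\<in>{1..m}. {v i, u j} \<in> E \<longrightarrow>
        (\<forall>k\<in>{1..i}. \<forall>l\<in>{1..j}. {v k, u l} \<in> E))"


section \<open>Dimension, Hilbert series, a-invariant and multiplicity\<close>

text \<open>Krull dimension: the supremum of the lengths \<open>l\<close> of chains \<open>P 0 \<subset> \<dots> \<subset> P l\<close> of primes.\<close>

definition prime_chain :: "('a, 'b) ring_scheme \<Rightarrow> nat \<Rightarrow> (nat \<Rightarrow> 'a set) \<Rightarrow> bool" where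
  "prime_chain A l P \<longleftrightarrow> (\<forall>i\<le>l. primeideal (P i) A) \<and> (\<forall>i<l. P i \<subset> P (Suc i))"

definition krull_dim :: "('a, 'b) ring_scheme \<Rightarrow> enat" where
  "krull_dim A = (SUP l\<in>{l. \<exists>P. prime_chain A l P}. enat l)"

text \<open>
  In the following, \<open>A\<close> is a ring containing the field \<open>F\<close>, and \<open>M d\<close> is the degree \<open>d\<close> component
  of a grading of \<open>A\<close>, viewed as a module over itself.
\<close>

definition hilbert_fun :: "('a, 'b) ring_scheme \<Rightarrow> 'a set \<Rightarrow> (nat \<Rightarrow> 'a set) \<Rightarrow> nat \<Rightarrow> nat" where
  "hilbert_fun A F M d = (THE r. ring.dimension A r F (M d))"

definition hilbert_series :: "('a, 'b) ring_scheme \<Rightarrow> 'a set \<Rightarrow> (nat \<Rightarrow> 'a set) \<Rightarrow> int fps" where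
  "hilbert_series A F M = Abs_fps (\<lambda>d. int (hilbert_fun A F M d))"

text \<open>The numerator \<open>h\<close> in \<open>h(t) / (1 - t)^\<delta>\<close>, where \<open>\<delta>\<close> is the Krull dimension.\<close>

definition h_poly :: "('a, 'b) ring_scheme \<Rightarrow> 'a set \<Rightarrow> (nat \<Rightarrow> 'a set) \<Rightarrow> int poly" where
  "h_poly A F M =
    (THE h. fps_of_poly h = hilbert_series A F M * (1 - fps_X) ^ the_enat (krull_dim A))"

definition a_invariant :: "('a, 'b) ring_scheme \<Rightarrow> 'a set \<Rightarrow> (nat \<Rightarrow> 'a set) \<Rightarrow> int" where
  "a_invariant A F M = int (Polynomial.degree (h_poly A F M)) - int (the_enat (krull_dim A))"

definition graded_multiplicity :: "('a, 'b) ring_scheme \<Rightarrow> 'a set \<Rightarrow> (nat \<Rightarrow> 'a set) \<Rightarrow> int" where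
  "graded_multiplicity A F M = poly (h_poly A F M) 1"

text \<open>
  The copy of the coefficient field in \<open>\<bbbK>[S]/I\<close>, and the standard grading of \<open>\<bbbK>[S]/I\<close> by the
  images of the homogeneous components of \<open>\<bbbK>[S]\<close>.
\<close>

definition quot_field :: "'x set \<Rightarrow> ('x, 'k::comm_ring_1) mpoly set \<Rightarrow> ('x, 'k) mpoly set set" where
  "quot_field S I = (\<lambda>c. I +>\<^bsub>mpoly_ring S\<^esub> mconst c) ` UNIV"

definition quot_part ::
  "'x set \<Rightarrow> ('x, 'k::comm_ring_1) mpoly set \<Rightarrow> nat \<Rightarrow> ('x, 'k) mpoly set set" where
  "quot_part S I d = (\<lambda>p. I +>\<^bsub>mpoly_ring S\<^esub> p) ` homog_part S d"


section \<open>The iterated sum\<close>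

text \<open>
  \<open>nested_sum lam k x\<close> is the sum over \<open>j\<^sub>k, \<dots>, j\<^sub>1\<close> of \<open>j\<^sub>1\<close>, where \<open>j\<^sub>k\<close> ends at \<open>x\<close>; for \<open>k = 0\<close>
  no summation remains and the summand is the last upper bound \<open>x\<close>. The subtraction on the
  naturals does not truncate because \<open>lam\<close> is nonincreasing.
\<close>

fun nested_sum :: "(nat \<Rightarrow> nat) \<Rightarrow> nat \<Rightarrow> nat \<Rightarrow> nat" where
  "nested_sum lam 0 x = x"
| "nested_sum lam (Suc k) x = (\<Sum>j = lam 2 - lam (Suc k + 2) + 1..x. nested_sum lam k j)"

text \<open>
  For \<open>n = 1\<close>, where the summand and \<open>lam 2\<close> are not defined, the value is 1: writing the summand as
  \<open>j\<^sub>1 = (\<Sum>j\<^sub>0 = 1..j\<^sub>1. 1)\<close>, the sum has \<open>n - 1\<close> indices \<open>j\<^bsub>n-2\<^esub>, \<dots>, j\<^sub>0\<close>, hence none for \<open>n = 1\<close>.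
\<close>

definition iterated_sum :: "(nat \<Rightarrow> nat) \<Rightarrow> nat \<Rightarrow> nat" where
  "iterated_sum lam n = (if n = 1 then 1 else nested_sum lam (n - 2) (lam 2))"

end

theory Submission
  imports Defs
begin

text \<open>
  The toric ring is spanned by the degree vectors of multigraphs supported on the Ferrers graph, so
  its Hilbert function counts these vectors. Exchanging the endpoints of two edges shows that a
  vector which is positive at \<open>v\<^sub>i\<close> and \<open>u\<^sub>j\<close> is still attained after removal of the corner edge
  \<open>v\<^sub>i u\<^sub>j\<close>. Hence the series \<open>F i j\<close> of the subgraph on the rows from \<open>i\<close> and the columns up to
  \<open>j\<close> satisfies \<open>(1 - t) F i j = F i (j-1) + F (i+1) j - F (i+1) (j-1)\<close>, which gives a recursion
  for the numerators with nonnegative coefficients; their degree and their value at 1 follow by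
  induction. For the Krull dimension, elements \<open>f\<^sub>i \<in> P\<^sub>i\<^sub>+\<^sub>1 - P\<^sub>i\<close> along a chain of primes have
  linearly independent monomials modulo \<open>P\<^sub>0\<close>, so that the growth of the Hilbert function bounds the
  length of the chain; killing the vertices one after another gives a chain of maximal length.
\<close>

section \<open>Degree vectors of multigraphs on a Ferrers graph\<close>

text \<open>The numerator is defined through the Krull dimension, and that dimension through chains
  of arbitrary primes instead of the pole of the series. So \<open>n + m - 1\<close> has to be found
  twice: as the exponent that clears the denominator and as the length of a longest chain. The
  primes need not be homogeneous, which is why the growth argument filters by degree at most
  \<open>D\<close> instead of using graded pieces.

  The obstacle in the series recursion is its negative term. After clearing denominators, whose
  exponents differ, it becomes \<open>- (1 - t) h\<close>. Its constant part cancels against the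
  preceding numerator, and only \<open>t\<close> times a sum over smaller column bounds is left.
  Without subtraction the support of the numerator can be followed exactly: every factor
  \<open>t\<close> lowers the column bound by at least one, and the numbers
  \<open>lam j + j - 3\<close> measure the room for these losses.\<close>

abbreviation lookup :: "('a \<Rightarrow>\<^sub>0 'b::zero) \<Rightarrow> 'a \<Rightarrow> 'b" where
  "lookup \<equiv> Poly_Mapping.lookup"

abbreviation keys :: "('a \<Rightarrow>\<^sub>0 'b::zero) \<Rightarrow> 'a set" where
  "keys \<equiv> Poly_Mapping.keys"

abbreviation single :: "'a \<Rightarrow> 'b \<Rightarrow> 'a \<Rightarrow>\<^sub>0 'b::zero" where
  "single \<equiv> Poly_Mapping.single"

section \<open>Iterated sumsets: the graded pieces of an affine semigroup\<close>

fun sums_of :: "'c::comm_monoid_add set \<Rightarrow> nat \<Rightarrow> 'c set" where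
  "sums_of M 0 = {0}"
| "sums_of M (Suc d) = (\<lambda>(a, b). a + b) ` (M \<times> sums_of M d)"

lemma finite_sums_of: "finite M \<Longrightarrow> finite (sums_of M d)"
  by (induction d) auto

lemma sums_of_empty: "sums_of {} d = (if d = 0 then {0} else {})"
  by (cases d) auto

lemma sums_of_add: "a \<in> M \<Longrightarrow> b \<in> sums_of M d \<Longrightarrow> a + b \<in> sums_of M (Suc d)"
  by auto

text \<open>By commutativity any summand can be moved to the front. The conclusion
  \<open>d > 0\<close> is carried along so that \<open>d - 1\<close> is a true predecessor.\<close>

lemma sums_of_extract:
  fixes M :: "('x \<Rightarrow>\<^sub>0 nat) set"
  assumes "\<mu> \<in> sums_of M d" "lookup \<mu> x > 0"
  shows "\<exists>a\<in>M. \<exists>\<nu>\<in>sums_of M (d - 1). lookup a x > 0 \<and> \<mu> = a + \<nu> \<and> d > 0"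
  using assms
proof (induction d arbitrary: \<mu>)
  case (Suc d)
  then obtain a \<nu> where an: "a \<in> M" "\<nu> \<in> sums_of M d" "\<mu> = a + \<nu>"
    by auto
  show ?case
  proof (cases "lookup a x > 0")
    case True
    with an show ?thesis by auto
  next
    case False
    with an Suc.prems have "lookup \<nu> x > 0"
      by (simp add: lookup_add)
    from Suc.IH[OF an(2) this] obtain b \<rho> where
      b: "b \<in> M" "\<rho> \<in> sums_of M (d - 1)" "lookup b x > 0" "\<nu> = b + \<rho>" "d > 0"
      by blast
    have "a + \<rho> \<in> sums_of M d"
      using sums_of_add[OF an(1) b(2)] b(5) by simp
    moreover have "\<mu> = b + (a + \<rho>)"
      using an b by (simp add: ac_simps)
    ultimately show ?thesis
      using b by auto
  qed
qed auto

text \<open>Natural exponents cannot cancel, so a sum vanishes at \<open>x\<close> only if every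
  summand does. On a graph this turns vanishing at a vertex into deletion of the vertex.\<close>

lemma sums_of_avoiding:
  fixes M :: "('x \<Rightarrow>\<^sub>0 nat) set"
  shows "{\<mu> \<in> sums_of M d. lookup \<mu> x = 0} = sums_of {a \<in> M. lookup a x = 0} d"
proof (induction d)
  case (Suc d)
  have "\<mu> \<in> sums_of {a \<in> M. lookup a x = 0} (Suc d) \<longleftrightarrow> \<mu> \<in> sums_of M (Suc d) \<and> lookup \<mu> x = 0" for \<mu>
  proof -
    have "\<mu> \<in> sums_of {a \<in> M. lookup a x = 0} (Suc d) \<longleftrightarrow>
       (\<exists>a b. a \<in> M \<and> lookup a x = 0 \<and> b \<in> {\<mu> \<in> sums_of M d. lookup \<mu> x = 0} \<and> \<mu> = a + b)"
      unfolding Suc by auto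
    also have "\<dots> \<longleftrightarrow> \<mu> \<in> sums_of M (Suc d) \<and> lookup \<mu> x = 0"
      by (auto simp: lookup_add)
    finally show ?thesis .
  qed
  then show ?case by blast
qed auto

lemma fps_of_poly_X: "fps_of_poly [:0, 1::int:] = fps_X"
  by (simp add: fps_of_poly_pCons)

lemma sum_reflect:
  fixes f :: "nat \<Rightarrow> 'a::comm_monoid_add"
  assumes "b \<le> c" "a \<le> c"
  shows "(\<Sum>l = a..b. f (c - l + 1)) = (\<Sum>j = c - b + 1..c - a + 1. f j)"
  by (rule sum.reindex_bij_witness[where i = "\<lambda>j. c + 1 - j" and j = "\<lambda>l. c - l + 1"])
    (use assms in auto)

section \<open>Ferrers shapes and the corner exchange\<close>

locale ferrers_shape =
  fixes n m :: nat and lam :: "nat \<Rightarrow> nat" and v u :: "nat \<Rightarrow> 'v"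
  assumes n_pos: "1 \<le> n"
    and inj_v: "inj_on v {1..n}" and inj_u: "inj_on u {1..m}"
    and disj: "v ` {1..n} \<inter> u ` {1..m} = {}"
    and lam_bounds: "\<And>i. 1 \<le> i \<Longrightarrow> i \<le> n \<Longrightarrow> 1 \<le> lam i \<and> lam i \<le> m"
    and lam_anti: "\<And>i k. 1 \<le> i \<Longrightarrow> i \<le> k \<Longrightarrow> k \<le> n \<Longrightarrow> lam k \<le> lam i"
begin

definition edge_mon :: "nat \<Rightarrow> nat \<Rightarrow> 'v \<Rightarrow>\<^sub>0 nat" where
  "edge_mon i j = single (v i) 1 + single (u j) 1"

text \<open>Two cut-offs make the family closed under both deletions in the recursion: removing
  \<open>v i\<close> raises \<open>i\<close>, and removing \<open>u j\<close> lowers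
  \<open>j\<close>.\<close>

definition edge_mons :: "nat \<Rightarrow> nat \<Rightarrow> ('v \<Rightarrow>\<^sub>0 nat) set" where
  "edge_mons i j = {edge_mon k l | k l. i \<le> k \<and> k \<le> n \<and> 1 \<le> l \<and> l \<le> j \<and> l \<le> lam k}"

lemma lookup_edge_mon_v:
  assumes "1 \<le> k" "k \<le> n" "1 \<le> l" "l \<le> lam k" "1 \<le> i" "i \<le> n"
  shows "lookup (edge_mon k l) (v i) = (if k = i then 1 else 0)"
proof -
  have l: "l \<in> {1..m}" using assms lam_bounds[of k] by auto
  have "v k = v i \<longleftrightarrow> k = i"
    using inj_on_eq_iff[OF inj_v] assms by simp
  moreover have "v i \<in> v ` {1..n}" "u l \<in> u ` {1..m}"
    using assms l by auto
  then have "u l \<noteq> v i"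
    using disj by (metis disjoint_iff)
  ultimately show ?thesis
    by (simp add: edge_mon_def lookup_add lookup_single when_def)
qed

lemma lookup_edge_mon_u:
  assumes "1 \<le> k" "k \<le> n" "1 \<le> l" "l \<le> lam k" "1 \<le> j" "j \<le> m"
  shows "lookup (edge_mon k l) (u j) = (if l = j then 1 else 0)"
proof -
  have l: "l \<in> {1..m}" using assms lam_bounds[of k] by auto
  have "u l = u j \<longleftrightarrow> l = j"
    using inj_on_eq_iff[OF inj_u] l assms by simp
  moreover have "v k \<in> v ` {1..n}" "u j \<in> u ` {1..m}"
    using assms by auto
  then have "v k \<noteq> u j"
    using disj by (metis disjoint_iff)
  ultimately show ?thesis
    by (simp add: edge_mon_def lookup_add lookup_single when_def)
qed

lemma finite_edge_mons: "finite (edge_mons i j)"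
proof -
  have "edge_mons i j \<subseteq> (\<lambda>(k, l). edge_mon k l) ` ({..n} \<times> {..j})"
    by (auto simp: edge_mons_def)
  then show ?thesis
    by (rule finite_subset) simp
qed

lemma edge_mons_avoiding_v:
  assumes "1 \<le> i" "i \<le> n"
  shows "{a \<in> edge_mons i j. lookup a (v i) = 0} = edge_mons (Suc i) j"
proof (intro equalityI subsetI)
  fix a assume "a \<in> {a \<in> edge_mons i j. lookup a (v i) = 0}"
  then obtain k l where kl: "a = edge_mon k l" "i \<le> k" "k \<le> n" "1 \<le> l" "l \<le> j" "l \<le> lam k"
    and "lookup a (v i) = 0"
    by (auto simp: edge_mons_def)
  then have "k \<noteq> i"
    using lookup_edge_mon_v[of k l i] assms by auto
  with kl show "a \<in> edge_mons (Suc i) j"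
    unfolding edge_mons_def by force
next
  fix a assume "a \<in> edge_mons (Suc i) j"
  then obtain k l where kl: "a = edge_mon k l" "Suc i \<le> k" "k \<le> n" "1 \<le> l" "l \<le> j" "l \<le> lam k"
    by (auto simp: edge_mons_def)
  then have "lookup a (v i) = 0"
    using lookup_edge_mon_v[of k l i] assms by auto
  moreover have "a \<in> edge_mons i j"
    using kl unfolding edge_mons_def by force
  ultimately show "a \<in> {a \<in> edge_mons i j. lookup a (v i) = 0}"
    by simp
qed

lemma edge_mons_avoiding_u:
  assumes "1 \<le> i" "1 \<le> j" "j \<le> m"
  shows "{a \<in> edge_mons i j. lookup a (u j) = 0} = edge_mons i (j - 1)"
proof (intro equalityI subsetI)
  fix a assume "a \<in> {a \<in> edge_mons i j. lookup a (u j) = 0}"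
  then obtain k l where kl: "a = edge_mon k l" "i \<le> k" "k \<le> n" "1 \<le> l" "l \<le> j" "l \<le> lam k"
    and "lookup a (u j) = 0"
    by (auto simp: edge_mons_def)
  then have "l \<noteq> j"
    using lookup_edge_mon_u[of k l j] assms by auto
  with kl show "a \<in> edge_mons i (j - 1)"
    unfolding edge_mons_def by force
next
  fix a assume "a \<in> edge_mons i (j - 1)"
  then obtain k l where kl: "a = edge_mon k l" "i \<le> k" "k \<le> n" "1 \<le> l" "l \<le> j - 1" "l \<le> lam k"
    by (auto simp: edge_mons_def)
  then have "lookup a (u j) = 0"
    using lookup_edge_mon_u[of k l j] assms by auto
  moreover have "a \<in> edge_mons i j"
    using kl unfolding edge_mons_def by force
  ultimately show "a \<in> {a \<in> edge_mons i j. lookup a (u j) = 0}"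
    by simp
qed

text \<open>
  The exchange \<open>v\<^sub>i u\<^sub>l \<cdot> v\<^sub>k u\<^sub>j = v\<^sub>i u\<^sub>j \<cdot> v\<^sub>k u\<^sub>l\<close> is available because \<open>l \<le> j \<le> lam k\<close>.
\<close>

lemma sums_of_corner:
  assumes i: "1 \<le> i" "i \<le> n" and j: "1 \<le> j" "j \<le> lam i"
    and \<mu>: "\<mu> \<in> sums_of (edge_mons i j) d" "lookup \<mu> (v i) > 0" "lookup \<mu> (u j) > 0"
  shows "\<exists>\<nu>\<in>sums_of (edge_mons i j) (d - 1). \<mu> = edge_mon i j + \<nu> \<and> d > 0"
proof -
  have jm: "j \<le> m" using j i lam_bounds[of i] by auto
  obtain a \<nu> where a: "a \<in> edge_mons i j" "lookup a (v i) > 0"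
    and \<nu>: "\<nu> \<in> sums_of (edge_mons i j) (d - 1)" "\<mu> = a + \<nu>" "d > 0"
    using sums_of_extract[OF \<mu>(1,2)] by blast
  from a(1) obtain k l where "a = edge_mon k l" "i \<le> k" "k \<le> n" "1 \<le> l" "l \<le> j" "l \<le> lam k"
    by (auto simp: edge_mons_def)
  moreover from this a(2) have "k = i"
    using lookup_edge_mon_v[of k l i] i by (auto split: if_splits)
  ultimately have l: "a = edge_mon i l" "1 \<le> l" "l \<le> j" "l \<le> lam i" by auto
  show ?thesis
  proof (cases "l = j")
    case True
    with l \<nu> show ?thesis by auto
  next
    case False
    \<comment> \<open>The edge that covers \<open>v i\<close> misses \<open>u j\<close>, so a second
      edge must cover \<open>u j\<close>; these two are the edges to be exchanged.\<close>
    then have "lookup a (u j) = 0"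
      using l i j jm lookup_edge_mon_u[of i l j] by simp
    with \<mu>(3) \<nu>(2) have "lookup \<nu> (u j) > 0"
      by (simp add: lookup_add)
    from sums_of_extract[OF \<nu>(1) this] obtain b \<rho> where
      b: "b \<in> edge_mons i j" "lookup b (u j) > 0" and
      \<rho>: "\<rho> \<in> sums_of (edge_mons i j) (d - 1 - 1)" "\<nu> = b + \<rho>" "d - 1 > 0"
      by blast
    from b(1) obtain k l' where k: "b = edge_mon k l'" "i \<le> k" "k \<le> n" "1 \<le> l'" "l' \<le> j" "l' \<le> lam k"
      by (auto simp: edge_mons_def)
    then have "l' = j"
      using b(2) lookup_edge_mon_u[of k l' j] i j jm by (auto split: if_splits)
    then have "edge_mon k l \<in> edge_mons i j"
      using k l unfolding edge_mons_def by force
    then have "edge_mon k l + \<rho> \<in> sums_of (edge_mons i j) (Suc (d - 1 - 1))"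
      using \<rho>(1) by (rule sums_of_add)
    moreover have "Suc (d - 1 - 1) = d - 1" using \<rho>(3) by simp
    moreover have "\<mu> = edge_mon i j + (edge_mon k l + \<rho>)"
      using \<nu>(2) \<rho>(2) l(1) k(1) \<open>l' = j\<close> by (simp add: edge_mon_def ac_simps)
    ultimately show ?thesis
      using \<nu>(3) by metis
  qed
qed

section \<open>Hilbert functions and series of the subgraphs\<close>

definition count :: "nat \<Rightarrow> nat \<Rightarrow> nat \<Rightarrow> nat" where
  "count i j d = card (sums_of (edge_mons i j) d)"

lemma count_0 [simp]: "count i j 0 = 1"
  by (simp add: count_def)

text \<open>Inclusion and exclusion: the vectors positive at both \<open>v i\<close> and
  \<open>u j\<close> are the translates of the degree \<open>d\<close> vectors by the corner edge,
  and all others vanish at one of the two vertices. The additive form avoids subtraction of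
  naturals.\<close>

lemma count_Suc:
  assumes i: "1 \<le> i" "i \<le> n" and j: "1 \<le> j" "j \<le> lam i"
  shows "count i j (Suc d) + count (Suc i) (j - 1) (Suc d) =
    count i j d + count i (j - 1) (Suc d) + count (Suc i) j (Suc d)"
proof -
  let ?S = "\<lambda>i j d. sums_of (edge_mons i j) d"
  have jm: "j \<le> m" using j i lam_bounds[of i] by auto
  have fin: "finite (?S i j d)" for i j d
    by (intro finite_sums_of finite_edge_mons)
  have A: "?S (Suc i) j' d' = {\<mu> \<in> ?S i j' d'. lookup \<mu> (v i) = 0}" for j' d'
    using sums_of_avoiding[of "edge_mons i j'" d' "v i"] edge_mons_avoiding_v[OF i] by simp
  have B: "?S i' (j - 1) d' = {\<mu> \<in> ?S i' j d'. lookup \<mu> (u j) = 0}" if "1 \<le> i'" for i' d'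
    using sums_of_avoiding[of "edge_mons i' j" d' "u j"] edge_mons_avoiding_u[OF that j(1) jm] by simp
  have mon: "edge_mon i j \<in> edge_mons i j"
    using i j unfolding edge_mons_def by auto
  have lk: "lookup (edge_mon i j) (v i) = 1" "lookup (edge_mon i j) (u j) = 1"
    using i j jm lookup_edge_mon_v[of i j i] lookup_edge_mon_u[of i j j] by auto
  let ?T = "(+) (edge_mon i j) ` ?S i j d"
  have T: "?T = {\<mu> \<in> ?S i j (Suc d). lookup \<mu> (v i) > 0 \<and> lookup \<mu> (u j) > 0}" (is "_ = ?T'")
  proof (intro equalityI subsetI)
    fix \<mu> assume "\<mu> \<in> ?T"
    then show "\<mu> \<in> ?T'"
      using sums_of_add[OF mon] lk by (auto simp: lookup_add)
  next
    fix \<mu> assume "\<mu> \<in> ?T'"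
    then show "\<mu> \<in> ?T"
      using sums_of_corner[OF i j, of \<mu> "Suc d"] by auto
  qed
  let ?U = "?S i (j - 1) (Suc d) \<union> ?S (Suc i) j (Suc d)"
  have int: "?S i (j - 1) (Suc d) \<inter> ?S (Suc i) j (Suc d) = ?S (Suc i) (j - 1) (Suc d)"
    using A[of "j - 1" "Suc d"] A[of j "Suc d"] B[of i "Suc d"] i by auto
  have "?S i j (Suc d) = ?T \<union> ?U"
    unfolding T A B[OF i(1)] by auto
  moreover have "?T \<inter> ?U = {}"
    unfolding T A B[OF i(1)] by auto
  ultimately have "card (?S i j (Suc d)) = card ?T + card ?U"
    using fin by (metis card_Un_disjoint finite_UnI finite_imageI)
  also have "card ?T = count i j d"
    unfolding count_def by (intro card_image) (simp add: inj_on_def)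
  finally show ?thesis
    using card_Un_Int[OF fin[of i "j-1" "Suc d"] fin[of "Suc i" j "Suc d"]] int
    by (simp add: count_def)
qed

lemma edge_mons_0: "edge_mons i 0 = {}"
  by (auto simp: edge_mons_def)

lemma edge_mons_past: "i > n \<Longrightarrow> edge_mons i j = {}"
  by (auto simp: edge_mons_def)

text \<open>Row \<open>i\<close> is the longest of the rows from \<open>i\<close> on, so columns
  beyond \<open>lam i\<close> contain no edge of this subgraph.\<close>

lemma edge_mons_min:
  assumes "1 \<le> i"
  shows "edge_mons i (min j (lam i)) = edge_mons i j"
proof -
  have "l \<le> lam i" if "i \<le> k" "k \<le> n" "l \<le> lam k" for k l
    using lam_anti[OF assms that(1,2)] that(3) by simp
  then show ?thesis
    unfolding edge_mons_def by (auto 4 4)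
qed

definition count_fps :: "nat \<Rightarrow> nat \<Rightarrow> int fps" where
  "count_fps i j = Abs_fps (\<lambda>d. int (count i j d))"

lemma count_fps_step:
  assumes i: "1 \<le> i" "i \<le> n" and j: "1 \<le> j" "j \<le> lam i"
  shows "(1 - fps_X) * count_fps i j =
    count_fps i (j - 1) + count_fps (Suc i) j - count_fps (Suc i) (j - 1)"
proof (rule fps_ext)
  fix d
  show "fps_nth ((1 - fps_X) * count_fps i j) d =
    fps_nth (count_fps i (j - 1) + count_fps (Suc i) j - count_fps (Suc i) (j - 1)) d"
  proof (cases d)
    \<comment> \<open>In degree 0 every subgraph has exactly the zero vector, and the identity reads
      1 = 1 + 1 - 1.\<close>
    case 0
    then show ?thesis by (simp add: count_fps_def algebra_simps)
  next
    case (Suc d')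
    have "int (count i j (Suc d')) + int (count (Suc i) (j - 1) (Suc d')) =
      int (count i j d') + int (count i (j - 1) (Suc d')) + int (count (Suc i) j (Suc d'))"
      using count_Suc[OF i j, of d'] by (simp only: flip: of_nat_add)
    then show ?thesis
      by (simp add: count_fps_def Suc left_diff_distrib del: of_nat_add)
  qed
qed

lemma count_fps_empty: "edge_mons i j = {} \<Longrightarrow> count_fps i j = 1"
  by (rule fps_ext) (simp add: count_fps_def count_def sums_of_empty)

text \<open>\<open>h_rows r j\<close> is the numerator of the last \<open>Suc r\<close> rows, cut off after column \<open>j\<close>.\<close>

primrec h_rows :: "nat \<Rightarrow> nat \<Rightarrow> int poly" where
  "h_rows 0 j = 1"
| "h_rows (Suc r) j = h_rows r (min j (lam (n - r)))
     + [:0, 1:] * (\<Sum>l = 1..<min j (lam (n - r)). h_rows r l)"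

text \<open>The exponent \<open>r + j\<close> is one less than the number of vertices,
  \<open>Suc r\<close> rows and \<open>j\<close> columns. The bound on \<open>j\<close> ensures that
  every column counted meets the top row. Rows are added in the outer induction, columns in the
  inner one.\<close>

lemma count_fps_h_rows:
  assumes "r < n" "1 \<le> j" "j \<le> lam (n - r)"
  shows "count_fps (n - r) j * (1 - fps_X) ^ (r + j) = fps_of_poly (h_rows r j)"
  using assms
proof (induction r arbitrary: j)
  case 0
  \<comment> \<open>A single row is a star, whose toric ring is a polynomial ring in
    \<open>j\<close> variables; its numerator is 1.\<close>
  from 0(2,3) show ?case
  proof (induction j rule: nat_induct_at_least)
    case base
    have "(1 - fps_X) * count_fps n 1 = 1"
      using count_fps_step[of n 1] n_pos lam_bounds[of n]
      by (simp add: count_fps_empty edge_mons_0 edge_mons_past)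
    then show ?case by (simp add: mult.commute)
  next
    case (Suc j)
    have "(1 - fps_X) * count_fps n (Suc j) = count_fps n j"
      using count_fps_step[of n "Suc j"] n_pos Suc
      by (simp add: count_fps_empty edge_mons_past)
    then have "count_fps n (Suc j) * (1 - fps_X) ^ Suc j = count_fps n j * (1 - fps_X) ^ j"
      by (simp add: mult_ac)
    then show ?case using Suc by (simp del: power_Suc)
  qed
next
  case (Suc r)
  define i where "i = n - Suc r"
  have i: "Suc i = n - r" "1 \<le> i" "i \<le> n" using Suc.prems(1) unfolding i_def by auto
  have rn: "r < n" using Suc.prems(1) by simp
  have li: "1 \<le> lam (Suc i)" "lam (Suc i) \<le> lam i"
    using lam_bounds[of "Suc i"] lam_anti[of i "Suc i"] i rn by auto
  have IH: "count_fps (Suc i) l * (1 - fps_X) ^ (r + l) = fps_of_poly (h_rows r l)"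
    if "1 \<le> l" "l \<le> lam (Suc i)" for l
    using Suc.IH[OF rn, of l] that i by simp
  have clip: "count_fps (Suc i) (min l (lam (Suc i))) = count_fps (Suc i) l" for l
    using edge_mons_min[of "Suc i" l] by (simp add: count_fps_def count_def)
  have "count_fps i j * (1 - fps_X) ^ (Suc r + j) = fps_of_poly (h_rows (Suc r) j)"
    using Suc.prems(2,3)
    unfolding i_def[symmetric]
  proof (induction j rule: nat_induct_at_least)
    case base
    have "(1 - fps_X) * count_fps i 1 = count_fps (Suc i) 1"
      using count_fps_step[of i 1] i li by (simp add: count_fps_empty edge_mons_0)
    then have "count_fps i 1 * (1 - fps_X) ^ (Suc r + 1) = count_fps (Suc i) 1 * (1 - fps_X) ^ (r + 1)"
      by (simp add: mult_ac)
    also have "\<dots> = fps_of_poly (h_rows r 1)"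
      using IH[of 1] li by simp
    finally show ?case
      using li i by simp
  next
    case (Suc j)
    have step: "(1 - fps_X) * count_fps i (Suc j) =
        count_fps i j + count_fps (Suc i) (Suc j) - count_fps (Suc i) j"
      using count_fps_step[of i "Suc j"] i Suc.prems by simp
    have IHj: "count_fps i j * (1 - fps_X) ^ (Suc r + j) = fps_of_poly (h_rows (Suc r) j)"
      using Suc by simp
    \<comment> \<open>The series have denominators of exponents \<open>Suc r + j\<close>,
      \<open>r + Suc j\<close> and \<open>r + j\<close>; the last one is smaller by one, hence the
      additional factor \<open>q\<close>.\<close>
    have distrib: "(a + b - c) * q ^ (Suc r + j) = a * q ^ (Suc r + j) + b * q ^ (r + Suc j)
        - q * (c * q ^ (r + j))" for a b c q :: "int fps"
      by (simp add: algebra_simps)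
    show ?case
    proof (cases "Suc j \<le> lam (Suc i)")
      case True
      have "count_fps i (Suc j) * (1 - fps_X) ^ (Suc r + Suc j) =
          ((1 - fps_X) * count_fps i (Suc j)) * (1 - fps_X) ^ (Suc r + j)"
        by (simp add: mult_ac)
      also have "\<dots> = fps_of_poly (h_rows (Suc r) j) + fps_of_poly (h_rows r (Suc j))
          - (1 - fps_X) * fps_of_poly (h_rows r j)"
        unfolding step distrib IHj IH[OF Suc.hyps Suc_leD[OF True]]
          IH[OF le_SucI[OF Suc.hyps] True] ..
      also have "\<dots> = fps_of_poly (h_rows (Suc r) j + h_rows r (Suc j)
          - (1 - [:0, 1:]) * h_rows r j)"
        by (simp add: fps_of_poly_add fps_of_poly_diff fps_of_poly_mult fps_of_poly_X)
      \<comment> \<open>The part \<open>- h_rows r j\<close> cancels the leading term of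
        \<open>h_rows (Suc r) j\<close>; what remains of the product is the new summand
        \<open>l = j\<close> of the sum.\<close>
      also have "h_rows (Suc r) j + h_rows r (Suc j) - (1 - [:0, 1:]) * h_rows r j
          = h_rows (Suc r) (Suc j)"
        using True i Suc.hyps by (simp add: algebra_simps min_def)
      finally show ?thesis .
    next
      case False
      \<comment> \<open>Column \<open>Suc j\<close> meets only row \<open>i\<close>, so it adds a
        free variable and leaves the numerator unchanged.\<close>
      then have clipped: "min (Suc j) (lam (Suc i)) = min j (lam (Suc i))" by simp
      then have "count_fps (Suc i) (Suc j) = count_fps (Suc i) j"
        using clip[of j] clip[of "Suc j"] by simp
      with step have "(1 - fps_X) * count_fps i (Suc j) = count_fps i j" by simp
      then have "count_fps i (Suc j) * (1 - fps_X) ^ (Suc r + Suc j) =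
          count_fps i j * (1 - fps_X) ^ (Suc r + j)"
        by (simp add: mult_ac)
      also have "\<dots> = fps_of_poly (h_rows (Suc r) (Suc j))"
        using IHj clipped i by (simp del: power_Suc)
      finally show ?thesis .
    qed
  qed
  then show ?case by (simp add: i_def)
qed

section \<open>The value of the numerator at 1\<close>

text \<open>At 1 the factor \<open>t\<close> disappears, and the leading term supplies the summand
  for the upper end that the sum in \<open>h_rows\<close> omits.\<close>

lemma h_rows_at_1_Suc:
  assumes "1 \<le> j" "r < n"
  shows "poly (h_rows (Suc r) j) 1 = (\<Sum>l = 1..min j (lam (n - r)). poly (h_rows r l) 1)"
proof -
  have "1 \<le> min j (lam (n - r))"
    using assms lam_bounds[of "n - r"] by simp
  then show ?thesis
    by (simp add: poly_sum sum.last_plus)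
qed

text \<open>
  Both sides count the sequences \<open>l\<^sub>2 \<ge> \<dots> \<ge> l\<^sub>n \<ge> 1\<close> with \<open>l\<^sub>i \<le> lam i\<close>. The recursion of
  \<^const>\<open>h_rows\<close> sums over \<open>l\<^sub>n\<close> first, the one of \<^const>\<open>nested_sum\<close> over \<open>l\<^sub>2\<close>, with
  \<open>j\<^sub>k = lam 2 - l\<^bsub>k+2\<^esub> + 1\<close>.
\<close>

lemma h_rows_at_1_partial:
  assumes "k + 3 \<le> n"
  shows "poly (h_rows (n - 1) (lam 1)) 1 =
    (\<Sum>l = 1..lam (k + 3). int (nested_sum lam k (lam 2 - l + 1)) * poly (h_rows (n - (k + 3)) l) 1)"
  using assms
proof (induction k)
  case 0
  let ?p = "\<lambda>r j. poly (h_rows r j) 1"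
  have n: "n - 1 = Suc (n - 2)" "n - (n - 2) = 2" "n - 2 = Suc (n - 3)" "n - (n - 3) = 3"
    using 0 by auto
  have l: "1 \<le> lam 3" "lam 3 \<le> lam 2" "lam 2 \<le> lam 1"
    using lam_bounds[of 3] lam_anti[of 2 3] lam_anti[of 1 2] 0 by auto
  have "?p (n - 1) (lam 1) = (\<Sum>l = 1..lam 2. ?p (n - 2) l)"
    using h_rows_at_1_Suc[of "lam 1" "n - 2"] l n 0 by (simp del: h_rows.simps add: min_def)
  also have "\<dots> = (\<Sum>l = 1..lam 2. \<Sum>l' = 1..min l (lam 3). ?p (n - 3) l')"
  proof (rule sum.cong[OF refl])
    fix l assume "l \<in> {1..lam 2}"
    then show "?p (n - 2) l = (\<Sum>l' = 1..min l (lam 3). ?p (n - 3) l')"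
      using h_rows_at_1_Suc[of l "n - 3"] n 0 by (simp del: h_rows.simps)
  qed
  \<comment> \<open>The bound \<open>min l (lam 3)\<close> is split into a fixed range and the
    relation \<open>l' \<le> l\<close>, the form in which the two sums can be interchanged.\<close>
  also have "\<dots> = (\<Sum>l = 1..lam 2. \<Sum>l' | l' \<in> {1..lam 3} \<and> l' \<le> l. ?p (n - 3) l')"
    by (intro sum.cong refl) auto
  also have "\<dots> = (\<Sum>l' = 1..lam 3. \<Sum>l | l \<in> {1..lam 2} \<and> l' \<le> l. ?p (n - 3) l')"
    by (rule sum.swap_restrict) auto
  \<comment> \<open>The weight is the number of \<open>l\<close> between \<open>l'\<close> and
    \<open>lam 2\<close>; it equals \<open>nested_sum lam 0\<close> at the reflected index.\<close>
  also have "\<dots> = (\<Sum>l' = 1..lam 3. int (lam 2 - l' + 1) * ?p (n - 3) l')"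
  proof (rule sum.cong[OF refl])
    fix l' assume l': "l' \<in> {1..lam 3}"
    then have "{l. l \<in> {1..lam 2} \<and> l' \<le> l} = {l'..lam 2}" by auto
    then show "(\<Sum>l | l \<in> {1..lam 2} \<and> l' \<le> l. ?p (n - 3) l') = int (lam 2 - l' + 1) * ?p (n - 3) l'"
      using l' l by (simp add: Suc_diff_le)
  qed
  finally show ?case by simp
next
  case (Suc k)
  let ?p = "\<lambda>r j. poly (h_rows r j) 1"
  let ?s = "\<lambda>l. int (nested_sum lam k (lam 2 - l + 1))"
  have n: "n - (k + 3) = Suc (n - (k + 4))" "n - (n - (k + 4)) = k + 4"
    using Suc.prems by auto
  have l: "lam (k + 4) \<le> lam (k + 3)" "lam (k + 3) \<le> lam 2"
    using lam_anti[of "k + 3" "k + 4"] lam_anti[of 2 "k + 3"] Suc.prems by auto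
  have "?p (n - 1) (lam 1) = (\<Sum>l = 1..lam (k + 3). ?s l * ?p (n - (k + 3)) l)"
    using Suc by simp
  also have "\<dots> = (\<Sum>l = 1..lam (k + 3). \<Sum>l' | l' \<in> {1..lam (k + 4)} \<and> l' \<le> l. ?s l * ?p (n - (k + 4)) l')"
  proof (rule sum.cong[OF refl])
    fix l assume "l \<in> {1..lam (k + 3)}"
    then have "?p (n - (k + 3)) l = (\<Sum>l' = 1..min l (lam (k + 4)). ?p (n - (k + 4)) l')"
      using h_rows_at_1_Suc[of l "n - (k + 4)"] n Suc.prems by (simp del: h_rows.simps)
    also have "\<dots> = (\<Sum>l' | l' \<in> {1..lam (k + 4)} \<and> l' \<le> l. ?p (n - (k + 4)) l')"
      by (intro sum.cong refl) auto
    finally show "?s l * ?p (n - (k + 3)) l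
        = (\<Sum>l' | l' \<in> {1..lam (k + 4)} \<and> l' \<le> l. ?s l * ?p (n - (k + 4)) l')"
      by (simp add: sum_distrib_left)
  qed
  also have "\<dots> = (\<Sum>l' = 1..lam (k + 4). \<Sum>l | l \<in> {1..lam (k + 3)} \<and> l' \<le> l. ?s l * ?p (n - (k + 4)) l')"
    by (rule sum.swap_restrict) auto
  also have "\<dots> = (\<Sum>l' = 1..lam (k + 4). int (nested_sum lam (Suc k) (lam 2 - l' + 1)) * ?p (n - (k + 4)) l')"
  proof (rule sum.cong[OF refl])
    fix l' assume l': "l' \<in> {1..lam (k + 4)}"
    then have "{l. l \<in> {1..lam (k + 3)} \<and> l' \<le> l} = {l'..lam (k + 3)}" by auto
    then have "(\<Sum>l | l \<in> {1..lam (k + 3)} \<and> l' \<le> l. ?s l * ?p (n - (k + 4)) l')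
        = (\<Sum>l = l'..lam (k + 3). ?s l) * ?p (n - (k + 4)) l'"
      by (simp add: sum_distrib_right)
    \<comment> \<open>The reflection \<open>j = lam 2 - l + 1\<close> reverses the range:
      \<open>lam (k + 3)\<close> gives the lower limit of the new index, and \<open>l'\<close> the
      upper one.\<close>
    also have "(\<Sum>l = l'..lam (k + 3). ?s l) = int (nested_sum lam (Suc k) (lam 2 - l' + 1))"
      using sum_reflect[OF l(2), where f = "\<lambda>j. int (nested_sum lam k j)" and a = l'] l' l
      by (simp add: numeral_3_eq_3 del: of_nat_Suc)
    finally show "(\<Sum>l | l \<in> {1..lam (k + 3)} \<and> l' \<le> l. ?s l * ?p (n - (k + 4)) l')
        = int (nested_sum lam (Suc k) (lam 2 - l' + 1)) * ?p (n - (k + 4)) l'" .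
  qed
  finally show ?case by (simp add: eval_nat_numeral)
qed

text \<open>The partial formula needs at least three rows, so the two shorter shapes are evaluated
  directly. For \<open>n = 1\<close> the conventional value 1 of the sum is the numerator
  itself.\<close>

lemma h_rows_at_1: "poly (h_rows (n - 1) (lam 1)) 1 = int (iterated_sum lam n)"
proof -
  consider "n = 1" | "n = 2" | "n \<ge> 3" using n_pos by linarith
  then show ?thesis
  proof cases
    case 1
    then have "n - 1 = 0" by simp
    then have "poly (h_rows (n - 1) (lam 1)) 1 = 1" by simp
    with 1 show ?thesis by (simp add: iterated_sum_def del: One_nat_def)
  next
    case 2
    have "1 \<le> lam 1" "lam n \<le> lam 1"
      using lam_bounds[of 1] lam_anti[of 1 n] n_pos by auto
    then have "poly (h_rows (Suc 0) (lam 1)) 1 = int (lam n)"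
      using h_rows_at_1_Suc[of "lam 1" 0] n_pos by (simp add: min_absorb2 del: h_rows.simps(2))
    moreover have "n - 1 = Suc 0" "iterated_sum lam n = lam n"
      using 2 by (simp_all add: iterated_sum_def)
    ultimately show ?thesis by metis
  next
    case 3
    define k where "k = n - 3"
    have k: "k + 3 = n" "n - 2 = Suc k" "Suc k + 2 = n" using 3 by (simp_all add: k_def)
    have l: "lam n \<le> lam 2" "1 \<le> lam 2" using lam_anti[of 2 n] lam_bounds[of 2] 3 by auto
    \<comment> \<open>With \<open>k = n - 3\<close> the remaining numerator is that of the last row
      alone, which is 1.\<close>
    have "poly (h_rows (n - 1) (lam 1)) 1 = (\<Sum>l = 1..lam n. int (nested_sum lam k (lam 2 - l + 1)))"
      using h_rows_at_1_partial[of k] unfolding k by simp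
    also have "\<dots> = (\<Sum>j = lam 2 - lam n + 1..lam 2. int (nested_sum lam k j))"
      using sum_reflect[OF l, where f = "\<lambda>j. int (nested_sum lam k j)"] l(2) by simp
    also have "\<dots> = int (iterated_sum lam n)"
      using 3 nested_sum.simps(2)[of lam k "lam 2", unfolded k]
      by (simp add: iterated_sum_def k del: nested_sum.simps)
    finally show ?thesis .
  qed
qed

section \<open>The support and the degree of the numerator\<close>

lemma coeff_h_rows_nonneg: "coeff (h_rows r j) k \<ge> 0"
proof (induction r arbitrary: j k)
  case 0
  then show ?case by (simp add: coeff_1)
next
  case (Suc r)
  then show ?case
    by (cases k) (auto simp: coeff_sum intro!: sum_nonneg add_nonneg_nonneg)
qed

text \<open>Unfolding \<open>h_rows\<close>, each lower row is passed or contributes a factor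
  \<open>t\<close>, and a factor strictly lowers the column bound, which must stay at least 1. It is
  best to take the \<open>k\<close> factors in the first \<open>k\<close> rows below, since
  postponing one leaves more decreases to be made later. At row \<open>n - r + q\<close> there are
  then \<open>k - q + 1\<close> decreases left, for which the bound \<open>lam (n - r + q)\<close>
  must leave room.\<close>

lemma coeff_h_rows_pos_iff:
  assumes "r < n" "1 \<le> j" "j \<le> lam (n - r)"
  shows "coeff (h_rows r j) k > 0 \<longleftrightarrow>
    k < j \<and> k \<le> r \<and> (\<forall>q\<in>{1..k}. k + 2 \<le> lam (n - r + q) + q)"
  using assms
proof (induction r arbitrary: j k)
  case 0
  then show ?case by (auto simp: coeff_1)
next
  case (Suc r)
  define i J where "i = n - Suc r" and "J = min j (lam (n - r))"
  have i: "n - r = Suc i" "n - Suc r = i" "1 \<le> i" using Suc.prems(1) unfolding i_def by auto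
  have J: "1 \<le> J" "J \<le> lam (n - r)" "J \<le> j"
    using lam_bounds[of "n - r"] Suc.prems by (auto simp: J_def)
  have Jeq: "k < J \<longleftrightarrow> k < j \<and> k < lam (Suc i)" for k
    by (auto simp: J_def i)
  define P where "P = (\<lambda>r j k. k < j \<and> k \<le> r \<and> (\<forall>q\<in>{1..k}. k + 2 \<le> lam (n - r + q) + q))"
  have IH: "coeff (h_rows r l) k > 0 \<longleftrightarrow> P r l k" if "1 \<le> l" "l \<le> J" for l k
    using Suc.IH[of l k] Suc.prems(1) that J by (simp add: P_def)
  show ?case
  proof (cases k)
    case 0
    have "coeff (h_rows (Suc r) j) 0 = coeff (h_rows r J) 0"
      by (simp add: J_def)
    then show ?thesis
      using IH[of J 0] J 0 by (simp add: P_def)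
  next
    case (Suc k')
    have "coeff (h_rows (Suc r) j) k = coeff (h_rows r J) k + (\<Sum>l = 1..<J. coeff (h_rows r l) k')"
      by (simp add: J_def Suc coeff_sum)
    moreover have "(\<Sum>l = 1..<J. coeff (h_rows r l) k') \<ge> 0"
      by (intro sum_nonneg coeff_h_rows_nonneg)
    moreover have "(\<Sum>l = 1..<J. coeff (h_rows r l) k') > 0 \<longleftrightarrow> (\<exists>l\<in>{1..<J}. coeff (h_rows r l) k' > 0)"
    proof
      assume "(\<Sum>l = 1..<J. coeff (h_rows r l) k') > 0"
      then show "\<exists>l\<in>{1..<J}. coeff (h_rows r l) k' > 0"
        by (metis less_irrefl not_less sum_nonpos)
    next
      assume "\<exists>l\<in>{1..<J}. coeff (h_rows r l) k' > 0"
      then show "(\<Sum>l = 1..<J. coeff (h_rows r l) k') > 0"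
        by (auto intro!: sum_pos2 coeff_h_rows_nonneg)
    qed
    ultimately have "coeff (h_rows (Suc r) j) k > 0 \<longleftrightarrow>
        coeff (h_rows r J) k > 0 \<or> (\<exists>l\<in>{1..<J}. coeff (h_rows r l) k' > 0)"
      using coeff_h_rows_nonneg[of r J k] by linarith
    also have "\<dots> \<longleftrightarrow> P r J k \<or> (\<exists>l\<in>{1..<J}. P r l k')"
      using IH J(1) by auto
    also have "\<dots> \<longleftrightarrow> P (Suc r) j k"
    proof
      assume "P r J k \<or> (\<exists>l\<in>{1..<J}. P r l k')"
      then show "P (Suc r) j k"
      proof
        \<comment> \<open>Row \<open>Suc i\<close> is passed without a factor. The conditions for
          the later rows then hold with one unit to spare, and \<open>k < J\<close> gives the one
          for \<open>q = 1\<close>.\<close>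
        assume A: "P r J k"
        have "k + 2 \<le> lam (i + q) + q" if q: "q \<in> {1..k}" for q
        proof (cases "q = 1")
          case True
          with A show ?thesis by (auto simp: P_def Jeq)
        next
          case False
          then have "q - 1 \<in> {1..k}" using q by auto
          with A have "k + 2 \<le> lam (Suc i + (q - 1)) + (q - 1)"
            by (auto simp: P_def i)
          with False q show ?thesis by simp
        qed
        with A show ?thesis by (auto simp: P_def i Jeq)
      next
        \<comment> \<open>Row \<open>Suc i\<close> contributes a factor, and \<open>k'\<close>
          decreases remain.\<close>
        assume "\<exists>l\<in>{1..<J}. P r l k'"
        then have A: "k' + 1 < J" "k' \<le> r" "\<And>q. q \<in> {1..k'} \<Longrightarrow> k' + 2 \<le> lam (Suc i + q) + q"
          by (auto simp: P_def i)
        have "k + 2 \<le> lam (i + q) + q" if q: "q \<in> {1..k}" for q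
        proof (cases "q = 1")
          case True
          with A(1) Suc show ?thesis by (auto simp: Jeq)
        next
          case False
          then have "q - 1 \<in> {1..k'}" using q Suc by auto
          from A(3)[OF this] False q Suc show ?thesis by simp
        qed
        with A(1,2) Suc show ?thesis by (auto simp: P_def i Jeq)
      qed
    next
      assume A: "P (Suc r) j k"
      then have B: "k < j" "k' \<le> r" "\<And>q. q \<in> {1..k} \<Longrightarrow> k + 2 \<le> lam (i + q) + q"
        using Suc by (auto simp: P_def i)
      have "k < J"
        using B(1) B(3)[of 1] Suc by (auto simp: Jeq)
      moreover have "k' + 2 \<le> lam (Suc i + q) + q" if "q \<in> {1..k'}" for q
        using B(3)[of "Suc q"] that Suc by auto
      \<comment> \<open>The least column bound with room for \<open>k'\<close> further decreases is
        \<open>k' + 1 = k\<close>, so \<open>l = k\<close> is the witness.\<close>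
      ultimately have "P r k k'" "k \<in> {1..<J}"
        using B(2) Suc by (auto simp: P_def i)
      then show "P r J k \<or> (\<exists>l\<in>{1..<J}. P r l k')" by blast
    qed
    finally show ?thesis by (simp add: P_def)
  qed
qed

lemma degree_h_rows:
  assumes "\<And>k. (k < lam 1 \<and> k < n \<and> (\<forall>q\<in>{1..k}. k + 2 \<le> lam (1 + q) + q)) \<Longrightarrow> k \<le> D"
    and "D < lam 1" "D < n" "\<forall>q\<in>{1..D}. D + 2 \<le> lam (1 + q) + q"
  shows "degree (h_rows (n - 1) (lam 1)) = D"
proof (rule antisym)
  have l: "1 \<le> lam 1" using lam_bounds[of 1] n_pos by auto
  have *: "coeff (h_rows (n - 1) (lam 1)) k > 0 \<longleftrightarrow>
      k < lam 1 \<and> k < n \<and> (\<forall>q\<in>{1..k}. k + 2 \<le> lam (1 + q) + q)" for k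
    using coeff_h_rows_pos_iff[of "n - 1" "lam 1" k] l n_pos by auto
  then show "degree (h_rows (n - 1) (lam 1)) \<le> D"
    using assms(1) coeff_h_rows_nonneg
    by (intro degree_le) (metis linorder_not_le order_le_less)
  show "D \<le> degree (h_rows (n - 1) (lam 1))"
    using *[of D] assms(2-) by (intro le_degree) auto
qed

end


section \<open>Substitution of monomials\<close>

text \<open>The predicate \<open>P\<close> selects the monomials that survive: all of them for the
  toric map, those supported on the kept vertices for the passage to a face.\<close>

definition subst_mon :: "('m \<Rightarrow> bool) \<Rightarrow> ('m \<Rightarrow> 'l) \<Rightarrow> ('m \<Rightarrow>\<^sub>0 'k::comm_ring_1) \<Rightarrow> 'l \<Rightarrow>\<^sub>0 'k" where
  "subst_mon P g p = (\<Sum>\<mu>\<in>keys p. if P \<mu> then single (g \<mu>) (lookup p \<mu>) else 0)"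

lemma subst_mon_superset:
  assumes "finite A" "keys p \<subseteq> A"
  shows "subst_mon P g p = (\<Sum>\<mu>\<in>A. if P \<mu> then single (g \<mu>) (lookup p \<mu>) else 0)"
  unfolding subst_mon_def
  by (rule sum.mono_neutral_left) (use assms in \<open>auto simp: in_keys_iff\<close>)

lemma subst_mon_0 [simp]: "subst_mon P g 0 = 0"
  by (simp add: subst_mon_def)

lemma subst_mon_single [simp]:
  "subst_mon P g (single \<mu> c) = (if P \<mu> then single (g \<mu>) c else 0)"
  by (simp add: subst_mon_superset[of "{\<mu>}"])

lemma subst_mon_add: "subst_mon P g (p + q) = subst_mon P g p + subst_mon P g q"
proof -
  let ?A = "keys p \<union> keys q"
  have "finite ?A" "keys (p + q) \<subseteq> ?A" "keys p \<subseteq> ?A" "keys q \<subseteq> ?A"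
    using keys_add[of p q] by auto
  note eq = subst_mon_superset[OF this(1,2)] subst_mon_superset[OF this(1,3)]
    subst_mon_superset[OF this(1,4)]
  show ?thesis
    unfolding eq sum.distrib[symmetric]
    by (rule sum.cong) (auto simp: lookup_add single_add)
qed

lemma subst_mon_sum: "subst_mon P g (sum f A) = (\<Sum>a\<in>A. subst_mon P g (f a))"
  by (induction A rule: infinite_finite_induct) (auto simp: subst_mon_add)

lemma poly_mapping_sum_single: "(\<Sum>\<mu>\<in>keys p. single \<mu> (lookup p \<mu>)) = p"
proof (rule poly_mapping_eqI)
  fix \<nu>
  have "lookup (\<Sum>\<mu>\<in>keys p. single \<mu> (lookup p \<mu>)) \<nu> = (\<Sum>\<mu>\<in>keys p. if \<mu> = \<nu> then lookup p \<mu> else 0)"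
    by (simp add: lookup_sum lookup_single when_def)
  then show "lookup (\<Sum>\<mu>\<in>keys p. single \<mu> (lookup p \<mu>)) \<nu> = lookup p \<nu>"
    by (simp add: in_keys_iff)
qed

text \<open>The condition on \<open>P\<close> says that a product of monomials is killed exactly
  when one of its factors is, as for a face of a monoid.\<close>

lemma subst_mon_mult:
  fixes p q :: "'m::comm_monoid_add \<Rightarrow>\<^sub>0 'k::comm_ring_1"
  assumes "\<And>a b. P (a + b) \<longleftrightarrow> P a \<and> P b" "\<And>a b. g (a + b) = (g a + g b :: 'l::comm_monoid_add)"
  shows "subst_mon P g (p * q) = subst_mon P g p * subst_mon P g q"
proof -
  let ?s = "\<lambda>p \<mu>. single \<mu> (lookup p \<mu>)"
  have "p * q = (\<Sum>a\<in>keys p. \<Sum>b\<in>keys q. ?s p a * ?s q b)"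
    by (simp only: sum_product[symmetric] poly_mapping_sum_single)
  then have "subst_mon P g (p * q) = (\<Sum>a\<in>keys p. \<Sum>b\<in>keys q. subst_mon P g (?s p a * ?s q b))"
    by (simp add: subst_mon_sum)
  also have "\<dots> = (\<Sum>a\<in>keys p. \<Sum>b\<in>keys q.
      (if P a then single (g a) (lookup p a) else 0) * (if P b then single (g b) (lookup q b) else 0))"
    by (intro sum.cong refl) (auto simp: mult_single assms)
  also have "\<dots> = subst_mon P g p * subst_mon P g q"
    by (simp only: subst_mon_def sum_product)
  finally show ?thesis .
qed

lemma subst_mon_mconst:
  assumes "P 0" "g 0 = 0"
  shows "subst_mon P g (mconst c) = mconst c"
  using assms by (simp add: mconst_def)

lemma keys_subst_mon: "keys (subst_mon P g p) \<subseteq> g ` keys p"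
proof -
  have "keys (subst_mon P g p) \<subseteq> (\<Union>\<mu>\<in>keys p. keys (if P \<mu> then single (g \<mu>) (lookup p \<mu>) else 0))"
    unfolding subst_mon_def by (rule keys_sum)
  also have "\<dots> \<subseteq> g ` keys p"
    by (auto split: if_splits)
  finally show ?thesis .
qed


section \<open>The polynomial ring\<close>

lemma keys_mult_nat: "keys (a + b :: 'x \<Rightarrow>\<^sub>0 nat) = keys a \<union> keys b"
  by (auto simp: in_keys_iff lookup_add)

lemma mpoly_ring_simps [simp]:
  "x \<otimes>\<^bsub>mpoly_ring S\<^esub> y = x * y" "x \<oplus>\<^bsub>mpoly_ring S\<^esub> y = x + y"
  "\<one>\<^bsub>mpoly_ring S\<^esub> = 1" "\<zero>\<^bsub>mpoly_ring S\<^esub> = 0"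
  by (simp_all add: mpoly_ring_def)

lemma mem_mpoly_ring:
  "p \<in> carrier (mpoly_ring S) \<longleftrightarrow> (\<forall>\<mu>\<in>keys p. keys \<mu> \<subseteq> S)"
  by (simp add: mpoly_ring_def)

lemma mpoly_ring_uminus_closed:
  "p \<in> carrier (mpoly_ring S) \<Longrightarrow> - p \<in> carrier (mpoly_ring S)"
  by (auto simp: mem_mpoly_ring in_keys_iff)

lemma mpoly_ring_closed:
  assumes "p \<in> carrier (mpoly_ring S)" "q \<in> carrier (mpoly_ring S)"
  shows "p + q \<in> carrier (mpoly_ring S)" "p * q \<in> carrier (mpoly_ring S)"
    "p - q \<in> carrier (mpoly_ring S)"
proof -
  show "p + q \<in> carrier (mpoly_ring S)"
    using assms keys_add[of p q] by (auto simp: mem_mpoly_ring)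
  show "p * q \<in> carrier (mpoly_ring S)"
    unfolding mem_mpoly_ring
  proof
    fix \<mu> assume "\<mu> \<in> keys (p * q)"
    then obtain a b where "a \<in> keys p" "b \<in> keys q" "\<mu> = a + b"
      using keys_mult[of p q] by blast
    then show "keys \<mu> \<subseteq> S"
      using assms by (simp add: keys_mult_nat mem_mpoly_ring)
  qed
  have "keys (p - q) \<subseteq> keys p \<union> keys q"
    by (auto simp: in_keys_iff lookup_minus)
  then show "p - q \<in> carrier (mpoly_ring S)"
    using assms by (auto simp: mem_mpoly_ring)
qed

lemma mconst_closed: "mconst c \<in> carrier (mpoly_ring S)"
  by (auto simp: mem_mpoly_ring mconst_def)

lemma zero_closed_mpoly: "0 \<in> carrier (mpoly_ring S)"
  and one_closed_mpoly: "1 \<in> carrier (mpoly_ring S)"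
  by (auto simp: mem_mpoly_ring)

lemma cring_mpoly_ring: "cring (mpoly_ring S :: ('x, 'k::comm_ring_1) mpoly ring)"
proof (rule cringI)
  show "abelian_group (mpoly_ring S :: ('x, 'k) mpoly ring)"
  proof (rule abelian_groupI)
    fix x :: "('x, 'k) mpoly" assume "x \<in> carrier (mpoly_ring S)"
    then show "\<exists>y\<in>carrier (mpoly_ring S). y \<oplus>\<^bsub>mpoly_ring S\<^esub> x = \<zero>\<^bsub>mpoly_ring S\<^esub>"
      by (intro bexI[of _ "- x"]) (auto simp: mpoly_ring_uminus_closed)
  qed (auto simp: mpoly_ring_closed zero_closed_mpoly ac_simps)
  show "comm_monoid (mpoly_ring S :: ('x, 'k) mpoly ring)"
    by (rule comm_monoidI) (auto simp: mpoly_ring_closed one_closed_mpoly ac_simps)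
qed (auto simp: distrib_right)

lemma mconst_0: "mconst 0 = 0" and mconst_1: "mconst 1 = 1"
  and mconst_add: "mconst (a + b) = mconst a + mconst b"
  and mconst_mult: "mconst (a * b) = mconst a * mconst b"
  and mconst_uminus: "mconst (- a) = - mconst a"
  by (simp_all add: mconst_def single_add mult_single single_uminus)

lemma mconst_mult_single: "mconst c * single \<mu> x = single \<mu> (c * x)"
  by (simp add: mconst_def mult_single)

lemma lookup_mconst_mult: "lookup (mconst c * p) \<nu> = c * lookup p \<nu>"
  by (subst (1 2) poly_mapping_sum_single[of p, symmetric])
     (simp only: sum_distrib_left mconst_mult_single lookup_sum lookup_single mult_when)

lemma vector_space_mpoly:
  "vector_space (\<lambda>(c::'k::field) (p::('x, 'k) mpoly). mconst c * p)"
  by unfold_locales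
    (simp_all add: mconst_add mconst_mult mconst_1 distrib_left distrib_right mult.assoc)

lemma subfield_mconst:
  "subfield (range mconst) (mpoly_ring S :: ('x, 'k::field) mpoly ring)"
proof -
  interpret cring "mpoly_ring S :: ('x, 'k) mpoly ring" by (rule cring_mpoly_ring)
  let ?R = "mpoly_ring S :: ('x, 'k) mpoly ring"
  have minus: "\<ominus>\<^bsub>?R\<^esub> x = - x" if "x \<in> carrier ?R" for x
    using that by (intro minus_equality) (auto simp: mpoly_ring_uminus_closed)
  show ?thesis
  proof (rule subfieldI)
    show "subcring (range mconst) ?R"
    proof (rule subcringI', rule subringI)
      show "range mconst \<subseteq> carrier ?R" by (auto simp: mconst_closed)
      show "\<one>\<^bsub>?R\<^esub> \<in> range mconst" using mconst_1 by (metis mpoly_ring_simps(3) rangeI)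
      fix h :: "('x, 'k) mpoly" assume "h \<in> range mconst"
      then show "\<ominus>\<^bsub>?R\<^esub> h \<in> range mconst"
        by (auto simp: minus mconst_closed mconst_uminus[symmetric])
    next
      fix h h' :: "('x, 'k) mpoly" assume "h \<in> range mconst" "h' \<in> range mconst"
      then show "h \<otimes>\<^bsub>?R\<^esub> h' \<in> range mconst" "h \<oplus>\<^bsub>?R\<^esub> h' \<in> range mconst"
        by (auto simp: mconst_mult[symmetric] mconst_add[symmetric])
    qed
    have inv: "mconst c * mconst (inverse c) = (1 :: ('x, 'k) mpoly)" if "c \<noteq> 0" for c
      using that by (simp add: mconst_mult[symmetric] mconst_1)
    have nz: "mconst c = (0 :: ('x, 'k) mpoly) \<longleftrightarrow> c = 0" for c
      by (metis lookup_single_eq lookup_zero mconst_0 mconst_def)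
    show "Units (?R\<lparr>carrier := range mconst\<rparr>) = range mconst - {\<zero>\<^bsub>?R\<^esub>}"
    proof (intro equalityI subsetI)
      fix x assume "x \<in> Units (?R\<lparr>carrier := range mconst\<rparr>)"
      then show "x \<in> range mconst - {\<zero>\<^bsub>?R\<^esub>}"
        by (auto simp: Units_def)
    next
      fix x assume "x \<in> range mconst - {\<zero>\<^bsub>?R\<^esub>}"
      then obtain c where "x = mconst c" "c \<noteq> 0"
        using nz by auto
      then show "x \<in> Units (?R\<lparr>carrier := range mconst\<rparr>)"
        using inv[of c] by (auto simp: Units_def mult.commute intro!: bexI[of _ "mconst (inverse c)"])
    qed
  qed
qed


section \<open>The toric homomorphism\<close>

definition edge_exp :: "('v set \<Rightarrow>\<^sub>0 nat) \<Rightarrow> 'v \<Rightarrow>\<^sub>0 nat" where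
  "edge_exp \<mu> = (\<Sum>e\<in>keys \<mu>. \<Sum>x\<in>e. single x (lookup \<mu> e))"

definition edge_vec :: "'v set \<Rightarrow> 'v \<Rightarrow>\<^sub>0 nat" where
  "edge_vec e = (\<Sum>x\<in>e. single x 1)"

lemma edge_exp_superset:
  assumes "finite A" "keys \<mu> \<subseteq> A"
  shows "edge_exp \<mu> = (\<Sum>e\<in>A. \<Sum>x\<in>e. single x (lookup \<mu> e))"
  unfolding edge_exp_def
  by (rule sum.mono_neutral_left) (use assms in \<open>auto simp: in_keys_iff\<close>)

lemma edge_exp_add: "edge_exp (\<mu> + \<nu>) = edge_exp \<mu> + edge_exp \<nu>"
proof -
  let ?A = "keys \<mu> \<union> keys \<nu>"
  have "finite ?A" "keys (\<mu> + \<nu>) \<subseteq> ?A" "keys \<mu> \<subseteq> ?A" "keys \<nu> \<subseteq> ?A"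
    by (auto simp: keys_mult_nat)
  note eq = edge_exp_superset[OF this(1,2)] edge_exp_superset[OF this(1,3)]
    edge_exp_superset[OF this(1,4)]
  show ?thesis
    unfolding eq by (simp add: lookup_add single_add sum.distrib)
qed

lemma edge_exp_0 [simp]: "edge_exp 0 = 0"
  by (simp add: edge_exp_def)

lemma edge_exp_single: "edge_exp (single e 1) = edge_vec e"
  by (simp add: edge_exp_def edge_vec_def)

lemma prod_single_1: "(\<Prod>a\<in>A. single (f a) 1) = single (sum f A) 1"
  by (induction A rule: infinite_finite_induct) (auto simp: mult_single)

lemma single_edge_vec_power:
  "single (edge_vec e) (1 :: 'b::comm_semiring_1) ^ k = single (\<Sum>x\<in>e. single x k) 1"
proof (induction k)
  case (Suc k)
  have "single (edge_vec e) 1 ^ Suc k = single (edge_vec e + (\<Sum>x\<in>e. single x k)) (1 :: 'b)"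
    by (simp add: Suc.IH mult_single)
  also have "edge_vec e + (\<Sum>x\<in>e. single x k) = (\<Sum>x\<in>e. single x (Suc k))"
    unfolding edge_vec_def sum.distrib[symmetric] single_add[symmetric] by simp
  finally show ?case .
qed simp

text \<open>As a substitution of monomials along an additive map, \<open>edge_hom\<close> inherits
  the homomorphism laws.\<close>

lemma edge_hom_eq: "edge_hom = subst_mon (\<lambda>_. True) edge_exp"
  by (rule ext)
    (simp only: edge_hom_def subst_mon_def edge_exp_def mvar_def prod_single_1
      edge_vec_def[symmetric] single_edge_vec_power mconst_def mult_single if_True add_0 mult_1_right)

lemma edge_hom_add: "edge_hom (p + q) = edge_hom p + edge_hom q"
  and edge_hom_mult: "edge_hom (p * q) = edge_hom p * edge_hom q"
  and edge_hom_mconst: "edge_hom (mconst c) = mconst c"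
  and edge_hom_sum: "edge_hom (sum f A) = (\<Sum>a\<in>A. edge_hom (f a))"
  and edge_hom_single: "edge_hom (single \<mu> c) = single (edge_exp \<mu>) c"
  unfolding edge_hom_eq
  by (simp_all add: subst_mon_add subst_mon_mult edge_exp_add subst_mon_mconst subst_mon_sum)

lemma edge_hom_uminus: "edge_hom (- p) = - edge_hom p"
  using edge_hom_mult[of "mconst (- 1)" p] unfolding edge_hom_mconst
  by (simp add: mconst_uminus mconst_1)

lemma edge_hom_diff: "edge_hom (p - q) = edge_hom p - edge_hom q"
  using edge_hom_add[of p "- q"] by (simp add: edge_hom_uminus)

lemma edge_hom_0 [simp]: "edge_hom 0 = 0"
  by (simp add: edge_hom_eq)

lemma edge_hom_1 [simp]: "edge_hom 1 = 1"
  using edge_hom_mconst[of 1] by (simp add: mconst_1)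

lemma keys_edge_hom: "keys (edge_hom p) \<subseteq> edge_exp ` keys p"
  unfolding edge_hom_eq by (rule keys_subst_mon)

lemma mdeg_superset:
  assumes "finite A" "keys \<mu> \<subseteq> A"
  shows "mdeg \<mu> = (\<Sum>x\<in>A. lookup \<mu> x)"
  unfolding mdeg_def
  by (rule sum.mono_neutral_left) (use assms in \<open>auto simp: in_keys_iff\<close>)

lemma mdeg_add: "mdeg (\<mu> + \<nu>) = mdeg \<mu> + mdeg \<nu>"
proof -
  let ?A = "keys \<mu> \<union> keys \<nu>"
  have "finite ?A" "keys (\<mu> + \<nu>) \<subseteq> ?A" "keys \<mu> \<subseteq> ?A" "keys \<nu> \<subseteq> ?A"
    by (auto simp: keys_mult_nat)
  note eq = mdeg_superset[OF this(1,2)] mdeg_superset[OF this(1,3)]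
    mdeg_superset[OF this(1,4)]
  show ?thesis
    unfolding eq by (simp add: lookup_add sum.distrib)
qed

lemma mdeg_0 [simp]: "mdeg 0 = 0"
  by (simp add: mdeg_def)

lemma mdeg_single [simp]: "mdeg (single x k) = k"
  by (simp add: mdeg_def)

lemma mdeg_eq_0_iff: "mdeg \<mu> = 0 \<longleftrightarrow> \<mu> = 0"
proof
  assume "mdeg \<mu> = 0"
  then have "lookup \<mu> x = 0" for x
    by (cases "x \<in> keys \<mu>") (auto simp: mdeg_def in_keys_iff)
  then show "\<mu> = 0" by (intro poly_mapping_eqI) simp
qed simp

text \<open>A monomial in the edges is a multigraph, and removing one edge lowers the degree by one
  and the exponent by an edge vector. This links the grading of the edge ring to sumsets.\<close>

lemma edge_exp_image:
  "edge_exp ` {\<mu>. keys \<mu> \<subseteq> E \<and> mdeg \<mu> = d} = sums_of (edge_vec ` E) d"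
proof (induction d)
  case 0
  have "{\<mu>. keys \<mu> \<subseteq> E \<and> mdeg \<mu> = 0} = {0}"
    by (auto simp: mdeg_eq_0_iff)
  then show ?case by simp
next
  case (Suc d)
  show ?case
  proof (intro equalityI subsetI)
    fix \<nu> assume "\<nu> \<in> edge_exp ` {\<mu>. keys \<mu> \<subseteq> E \<and> mdeg \<mu> = Suc d}"
    then obtain \<mu> where \<mu>: "\<nu> = edge_exp \<mu>" "keys \<mu> \<subseteq> E" "mdeg \<mu> = Suc d" by auto
    then have "\<mu> \<noteq> 0" by auto
    then obtain e where e: "e \<in> keys \<mu>"
      by (metis all_not_in_conv keys_eq_empty)
    define \<mu>' where "\<mu>' = \<mu> - single e 1"
    have dec: "\<mu> = single e 1 + \<mu>'"
      using e by (intro poly_mapping_eqI)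
        (auto simp: \<mu>'_def lookup_add lookup_minus lookup_single when_def in_keys_iff)
    then have "keys \<mu>' \<subseteq> E" "mdeg \<mu>' = d" "e \<in> E"
      using \<mu> e by (auto simp: keys_mult_nat mdeg_add)
    then have "edge_exp \<mu>' \<in> sums_of (edge_vec ` E) d" "edge_vec e \<in> edge_vec ` E"
      unfolding Suc[symmetric] by auto
    then show "\<nu> \<in> sums_of (edge_vec ` E) (Suc d)"
      using sums_of_add \<mu>(1) dec by (metis edge_exp_add edge_exp_single)
  next
    fix \<nu> assume "\<nu> \<in> sums_of (edge_vec ` E) (Suc d)"
    then obtain e \<mu> where "e \<in> E" "keys \<mu> \<subseteq> E" "mdeg \<mu> = d" "\<nu> = edge_vec e + edge_exp \<mu>"
      by (auto simp: Suc[symmetric])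
    then show "\<nu> \<in> edge_exp ` {\<mu>. keys \<mu> \<subseteq> E \<and> mdeg \<mu> = Suc d}"
      by (intro image_eqI[of _ _ "single e 1 + \<mu>"])
        (auto simp: edge_exp_add edge_exp_single keys_mult_nat mdeg_add simp del: One_nat_def)
  qed
qed

section \<open>The toric ring as a quotient and its Hilbert function\<close>

locale toric_ring =
  fixes V :: "'v set" and E :: "'v set set" and I :: "('v set, 'k::field) mpoly set"
  assumes graph: "simple_graph V E" and I_def: "I = toric_ideal V E"
begin

abbreviation cls :: "('v set, 'k) mpoly \<Rightarrow> ('v set, 'k) mpoly set" where
  "cls p \<equiv> I +>\<^bsub>mpoly_ring E\<^esub> p"

abbreviation A where "A \<equiv> mpoly_ring E Quot I"

lemma finite_E: "finite E"
proof (rule finite_subset)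
  show "E \<subseteq> Pow V" "finite (Pow V)" using graph by (auto simp: simple_graph_def)
qed

lemma keys_edge_exp:
  assumes "keys \<mu> \<subseteq> E"
  shows "keys (edge_exp \<mu>) \<subseteq> V"
proof -
  have "keys (edge_exp \<mu>) \<subseteq> (\<Union>e\<in>keys \<mu>. \<Union>x\<in>e. keys (single x (lookup \<mu> e)))"
    unfolding edge_exp_def by (intro order_trans[OF keys_sum] UN_mono keys_sum order_refl)
  also have "\<dots> \<subseteq> V"
    using assms graph by (fastforce simp: simple_graph_def split: if_splits)
  finally show ?thesis .
qed

sublocale hom: ring_hom_ring "mpoly_ring E" "mpoly_ring V" "edge_hom :: ('v set, 'k) mpoly \<Rightarrow> _"
proof (rule ring_hom_ringI)
  show "ring (mpoly_ring E :: ('v set, 'k) mpoly ring)" "ring (mpoly_ring V :: ('v, 'k) mpoly ring)"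
    by (rule cring.axioms(1)[OF cring_mpoly_ring])+
  fix x :: "('v set, 'k) mpoly" assume "x \<in> carrier (mpoly_ring E)"
  then show "edge_hom x \<in> carrier (mpoly_ring V)"
    using keys_edge_exp keys_edge_hom[of x] by (fastforce simp: mem_mpoly_ring)
next
  show "edge_hom \<one>\<^bsub>mpoly_ring E\<^esub> = (\<one>\<^bsub>mpoly_ring V\<^esub> :: ('v, 'k) mpoly)"
    by simp
qed (auto simp: edge_hom_add edge_hom_mult)

lemma I_kernel: "I = a_kernel (mpoly_ring E) (mpoly_ring V) edge_hom"
  by (simp add: I_def toric_ideal_def)

lemma mem_I: "p \<in> I \<longleftrightarrow> p \<in> carrier (mpoly_ring E) \<and> edge_hom p = 0"
  unfolding I_kernel a_kernel_def' by simp

sublocale ideal I "mpoly_ring E"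
  unfolding I_kernel by (rule hom.kernel_is_ideal)

lemma cls_eq_set:
  "p \<in> carrier (mpoly_ring E) \<Longrightarrow> cls p = {q \<in> carrier (mpoly_ring E). edge_hom q = edge_hom p}"
  unfolding I_kernel by (rule hom.rcos_eq_homeq)

lemma cls_eq_iff:
  assumes "p \<in> carrier (mpoly_ring E)" "q \<in> carrier (mpoly_ring E)"
  shows "cls p = cls q \<longleftrightarrow> edge_hom p = edge_hom q"
  using assms by (auto simp: cls_eq_set)

lemma cring_A: "cring A"
  by (rule quotient_is_cring[OF cring_mpoly_ring])

sublocale quot: cring A
  by (rule cring_A)

sublocale proj: ring_hom_ring "mpoly_ring E" A cls
  by (rule rcos_ring_hom_ring)

lemma carrier_A: "carrier A = cls ` carrier (mpoly_ring E)"
  by (auto simp: FactRing_def A_RCOSETS_def RCOSETS_def a_r_coset_def)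

lemma cls_mult:
  "p \<in> carrier (mpoly_ring E) \<Longrightarrow> q \<in> carrier (mpoly_ring E) \<Longrightarrow> cls p \<otimes>\<^bsub>A\<^esub> cls q = cls (p * q)"
  and cls_add:
  "p \<in> carrier (mpoly_ring E) \<Longrightarrow> q \<in> carrier (mpoly_ring E) \<Longrightarrow> cls p \<oplus>\<^bsub>A\<^esub> cls q = cls (p + q)"
  and cls_1: "cls 1 = \<one>\<^bsub>A\<^esub>" and cls_0: "cls 0 = \<zero>\<^bsub>A\<^esub>"
  using proj.hom_mult proj.hom_add proj.hom_one proj.hom_zero by auto

lemma cls_eq_zero_iff:
  assumes "p \<in> carrier (mpoly_ring E)"
  shows "cls p = \<zero>\<^bsub>A\<^esub> \<longleftrightarrow> edge_hom p = 0"
  unfolding cls_0[symmetric] cls_eq_iff[OF assms zero_closed_mpoly] by simp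

lemma subfield_quot_field: "subfield (quot_field E I) A"
proof -
  have "\<one>\<^bsub>A\<^esub> \<noteq> \<zero>\<^bsub>A\<^esub>"
    using cls_eq_zero_iff[OF one_closed_mpoly] by (simp add: cls_1)
  moreover have "quot_field E I = cls ` range mconst"
    by (auto simp: quot_field_def)
  ultimately show ?thesis
    using proj.img_is_subfield(2)[OF subfield_mconst] by simp
qed

lemma homog_part_closed:
  assumes "p \<in> homog_part E d" "q \<in> homog_part E d"
  shows "p + q \<in> homog_part E d" "p - q \<in> homog_part E d" "mconst c * p \<in> homog_part E d"
proof -
  show "p + q \<in> homog_part E d"
    using assms keys_add[of p q] by (auto simp: homog_part_def mpoly_ring_closed)
  show "p - q \<in> homog_part E d"
    using assms by (auto simp: homog_part_def mpoly_ring_closed in_keys_iff lookup_minus)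
  show "mconst c * p \<in> homog_part E d"
    using assms by (auto simp: homog_part_def mpoly_ring_closed mconst_closed in_keys_iff lookup_mconst_mult)
qed

lemma dimension_of_monomials:
  assumes "finite T" "T \<subseteq> sums_of (edge_vec ` E) d"
  shows "quot.dimension (card T) (quot_field E I) (cls ` {p \<in> homog_part E d. keys (edge_hom p) \<subseteq> T})"
  using assms
proof (induction T rule: finite_induct)
  case empty
  let ?P = "{p. (p :: ('v set, 'k) mpoly) \<in> homog_part E d \<and> keys (edge_hom p) \<subseteq> {}}"
  have "0 \<in> ?P"
    by (simp add: homog_part_def zero_closed_mpoly)
  moreover have "cls ` ?P = (\<lambda>_. \<zero>\<^bsub>A\<^esub>) ` ?P"
    by (rule image_cong[OF refl]) (simp add: homog_part_def cls_eq_zero_iff)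
  ultimately have "cls ` ?P = {\<zero>\<^bsub>A\<^esub>}"
    using image_constant[of 0 ?P "\<zero>\<^bsub>A\<^esub>"] by argo
  then show ?case by simp
next
  case (insert t T)
  let ?W = "\<lambda>T. {p \<in> homog_part E d. keys (edge_hom p) \<subseteq> T}"
  have hp: "p \<in> carrier (mpoly_ring E)" if "p \<in> homog_part E d" for p :: "('v set, 'k) mpoly"
    using that by (simp add: homog_part_def)
  obtain \<mu> where \<mu>: "keys \<mu> \<subseteq> E" "mdeg \<mu> = d" "t = edge_exp \<mu>"
    using insert.prems edge_exp_image[of E d] by auto
  define m :: "('v set, 'k) mpoly" where "m = single \<mu> 1"
  have m: "m \<in> homog_part E d" "edge_hom m = single t 1"
    using \<mu> by (auto simp: m_def homog_part_def mem_mpoly_ring edge_hom_single)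
  have "cls m \<notin> cls ` ?W T"
  proof
    assume "cls m \<in> cls ` ?W T"
    then obtain p where "p \<in> homog_part E d" "keys (edge_hom p) \<subseteq> T" "cls m = cls p" by auto
    moreover from this have "edge_hom p = single t 1"
      using cls_eq_iff[OF hp[OF m(1)] hp, of p] m(2) by simp
    ultimately show False
      using insert.hyps(2) by simp
  qed
  moreover have "quot.line_extension (quot_field E I) (cls m) (cls ` ?W T) = cls ` ?W (insert t T)"
  proof (intro equalityI subsetI)
    fix X assume "X \<in> quot.line_extension (quot_field E I) (cls m) (cls ` ?W T)"
    then obtain c p where p: "p \<in> ?W T" and "X = cls (mconst c) \<otimes>\<^bsub>A\<^esub> cls m \<oplus>\<^bsub>A\<^esub> cls p"
      by (auto simp: quot.line_extension_mem_iff quot_field_def)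
    then have "X = cls (mconst c * m + p)"
      using hp m(1) by (simp add: cls_mult cls_add mconst_closed mpoly_ring_closed)
    moreover have "mconst c * m + p \<in> ?W (insert t T)"
    proof -
      have "keys (edge_hom (mconst c * m + p)) \<subseteq> keys (mconst c * single t 1) \<union> keys (edge_hom p)"
        by (simp add: edge_hom_add edge_hom_mult edge_hom_mconst m(2) keys_add)
      moreover have "keys (mconst c * single t (1::'k)) \<subseteq> {t}"
        by (simp add: mconst_mult_single)
      ultimately show ?thesis
        using p m(1) by (auto intro: homog_part_closed)
    qed
    ultimately show "X \<in> cls ` ?W (insert t T)" by blast
  next
    fix X assume "X \<in> cls ` ?W (insert t T)"
    then obtain p where p: "p \<in> homog_part E d" "keys (edge_hom p) \<subseteq> insert t T" "X = cls p"
      by auto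
    \<comment> \<open>Subtracting the \<open>t\<close>-coefficient of the image times
      \<open>m\<close> brings the support of the image back into \<open>T\<close>.\<close>
    define c where "c = lookup (edge_hom p) t"
    define q where "q = p - mconst c * m"
    have q: "q \<in> homog_part E d"
      using p(1) m(1) by (auto simp: q_def intro: homog_part_closed)
    have "edge_hom q = edge_hom p - single t c"
      by (simp add: q_def edge_hom_diff edge_hom_mult edge_hom_mconst m(2) mconst_mult_single)
    then have "keys (edge_hom q) \<subseteq> T"
      using p(2) by (auto simp: in_keys_iff lookup_minus c_def lookup_single when_def split: if_splits)
    moreover have "X = cls (mconst c) \<otimes>\<^bsub>A\<^esub> cls m \<oplus>\<^bsub>A\<^esub> cls q"
      using hp m(1) q p(3) by (simp add: cls_mult cls_add mconst_closed mpoly_ring_closed q_def)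
    ultimately show "X \<in> quot.line_extension (quot_field E I) (cls m) (cls ` ?W T)"
      using q unfolding quot.line_extension_mem_iff quot_field_def by blast
  qed
  moreover have "cls m \<in> carrier A"
    using hp[OF m(1)] carrier_A by blast
  ultimately show ?case
    using quot.Suc_dim[of "cls m" "cls ` ?W T" "card T" "quot_field E I"] insert by auto
qed

lemma hilbert_fun_eq:
  "hilbert_fun A (quot_field E I) (quot_part E I) d = card (sums_of (edge_vec ` E) d)"
proof -
  let ?S = "sums_of (edge_vec ` E) d"
  \<comment> \<open>Taking \<open>T\<close> to be all attainable vectors imposes no restriction on a
    homogeneous polynomial, so the lemma measures the whole graded piece.\<close>
  have "{p \<in> homog_part E d. keys (edge_hom p) \<subseteq> ?S} = (homog_part E d :: ('v set, 'k) mpoly set)"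
  proof -
    have "keys (edge_hom p) \<subseteq> ?S" if "p \<in> homog_part E d" for p :: "('v set, 'k) mpoly"
    proof -
      have "keys p \<subseteq> {\<mu>. keys \<mu> \<subseteq> E \<and> mdeg \<mu> = d}"
        using that by (auto simp: homog_part_def mem_mpoly_ring)
      then show ?thesis
        using keys_edge_hom[of p] edge_exp_image[of E d] by blast
    qed
    then show ?thesis by blast
  qed
  moreover have "finite ?S"
    using finite_E by (intro finite_sums_of) auto
  ultimately have "quot.dimension (card ?S) (quot_field E I) (quot_part E I d)"
    using dimension_of_monomials[of ?S d] by (simp add: quot_part_def)
  then show ?thesis
    unfolding hilbert_fun_def
    using quot.dimension_is_inj[OF subfield_quot_field] by blast
qed

end


section \<open>Krull dimension\<close>

lemma mpoly_ring_sum_closed: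
  "(\<And>i. i \<in> J \<Longrightarrow> f i \<in> carrier (mpoly_ring S)) \<Longrightarrow> sum f J \<in> carrier (mpoly_ring S)"
  by (induction J rule: infinite_finite_induct) (auto simp: mpoly_ring_closed zero_closed_mpoly)

lemma mdeg_keys_mult:
  assumes "\<forall>\<mu>\<in>keys p. mdeg \<mu> \<le> a" "\<forall>\<mu>\<in>keys q. mdeg \<mu> \<le> b" "\<mu> \<in> keys (p * q)"
  shows "mdeg \<mu> \<le> a + b"
proof -
  obtain x y where "x \<in> keys p" "y \<in> keys q" "\<mu> = x + y"
    using keys_mult[of p q] assms(3) by blast
  then show ?thesis
    using assms(1,2) by (auto simp: mdeg_add intro!: add_mono)
qed

lemma keys_sum_nat: "finite S \<Longrightarrow> keys (\<Sum>x\<in>S. f x :: 'y \<Rightarrow>\<^sub>0 nat) = (\<Union>x\<in>S. keys (f x))"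
  by (induction S rule: finite_induct) (auto simp: keys_mult_nat)

lemma domain_mpoly_ring: "domain (mpoly_ring S :: (nat, 'k::idom) mpoly ring)"
proof (rule domain.intro[OF cring_mpoly_ring], unfold_locales)
qed auto

definition rename :: "('v \<Rightarrow> nat) \<Rightarrow> ('v \<Rightarrow>\<^sub>0 nat) \<Rightarrow> nat \<Rightarrow>\<^sub>0 nat" where
  "rename idx \<mu> = (\<Sum>x\<in>keys \<mu>. single (idx x) (lookup \<mu> x))"

lemma rename_superset:
  assumes "finite S" "keys \<mu> \<subseteq> S"
  shows "rename idx \<mu> = (\<Sum>x\<in>S. single (idx x) (lookup \<mu> x))"
  unfolding rename_def
  by (rule sum.mono_neutral_left) (use assms in \<open>auto simp: in_keys_iff\<close>)

lemma rename_add: "rename idx (\<mu> + \<nu>) = rename idx \<mu> + rename idx \<nu>"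
proof -
  let ?A = "keys \<mu> \<union> keys \<nu>"
  have "finite ?A" "keys (\<mu> + \<nu>) \<subseteq> ?A" "keys \<mu> \<subseteq> ?A" "keys \<nu> \<subseteq> ?A"
    by (auto simp: keys_mult_nat)
  note eq = rename_superset[OF this(1,2)] rename_superset[OF this(1,3)]
    rename_superset[OF this(1,4)]
  show ?thesis
    unfolding eq by (simp add: lookup_add single_add sum.distrib)
qed

lemma keys_rename: "keys (rename idx \<mu>) = idx ` keys \<mu>"
  by (auto simp: rename_def keys_sum_nat in_keys_iff)

lemma sum_split_add:
  fixes f :: "nat \<Rightarrow> 'a::comm_monoid_add"
  shows "(\<Sum>i<r + s. f i) = (\<Sum>i<r. f i) + (\<Sum>i<s. f (r + i))"
  by (induction s) (auto simp: ac_simps)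

section \<open>Chains of primes in the toric ring\<close>

context toric_ring
begin

text \<open>A lower bound \<open>r\<close> for the dimension of the image of the polynomials of
  degree at most \<open>D\<close> modulo \<open>P\<close>.\<close>

definition indep_mod :: "('v set, 'k) mpoly set \<Rightarrow> nat \<Rightarrow> nat \<Rightarrow> bool" where
  "indep_mod P r D \<longleftrightarrow> (\<exists>f.
     (\<forall>i<r. f i \<in> carrier (mpoly_ring E) \<and> (\<forall>\<mu>\<in>keys (f i). mdeg \<mu> \<le> D)) \<and>
     (\<forall>c. (\<Sum>i<r. mconst (c i) * f i) \<in> P \<longrightarrow> (\<forall>i<r. c i = 0)))"

lemma indep_mod_mono:
  assumes "indep_mod P r D" "I' \<subseteq> P" "D \<le> D'"
  shows "indep_mod I' r D'"
proof -
  obtain f where f: "\<forall>i<r. f i \<in> carrier (mpoly_ring E) \<and> (\<forall>\<mu>\<in>keys (f i). mdeg \<mu> \<le> D)"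
      "\<forall>c. (\<Sum>i<r. mconst (c i) * f i) \<in> P \<longrightarrow> (\<forall>i<r. c i = 0)"
    using assms(1) unfolding indep_mod_def by blast
  from f(1) have "\<forall>i<r. f i \<in> carrier (mpoly_ring E) \<and> (\<forall>\<mu>\<in>keys (f i). mdeg \<mu> \<le> D')"
    using assms(3) by (blast intro: order_trans)
  moreover have "\<forall>c. (\<Sum>i<r. mconst (c i) * f i) \<in> I' \<longrightarrow> (\<forall>i<r. c i = 0)"
    using f(2) assms(2) by blast
  ultimately show ?thesis
    unfolding indep_mod_def by blast
qed

text \<open>
  The family for \<open>P\<close> is the one for \<open>Q\<close> together with \<open>f\<close> times the one for \<open>P\<close>.
\<close>

lemma indep_mod_step:
  assumes P: "primeideal P (mpoly_ring E)" and Q: "primeideal Q (mpoly_ring E)" and "P \<subseteq> Q"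
    and f: "f \<in> Q" "f \<notin> P" "\<forall>\<mu>\<in>keys f. mdeg \<mu> \<le> k"
    and "indep_mod Q r D" "indep_mod P s D'"
  shows "indep_mod P (r + s) (max D (D' + k))"
proof -
  interpret P: primeideal P "mpoly_ring E" by (rule P)
  interpret Q: primeideal Q "mpoly_ring E" by (rule Q)
  have fc: "f \<in> carrier (mpoly_ring E)"
    using f(1) Q.a_subset by blast
  obtain g where g: "\<And>i. i < r \<Longrightarrow> g i \<in> carrier (mpoly_ring E)"
      "\<And>i \<mu>. i < r \<Longrightarrow> \<mu> \<in> keys (g i) \<Longrightarrow> mdeg \<mu> \<le> D"
      "\<And>c i. (\<Sum>i<r. mconst (c i) * g i) \<in> Q \<Longrightarrow> i < r \<Longrightarrow> c i = 0"
    using \<open>indep_mod Q r D\<close> unfolding indep_mod_def by blast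
  obtain h where h: "\<And>i. i < s \<Longrightarrow> h i \<in> carrier (mpoly_ring E)"
      "\<And>i \<mu>. i < s \<Longrightarrow> \<mu> \<in> keys (h i) \<Longrightarrow> mdeg \<mu> \<le> D'"
      "\<And>c i. (\<Sum>i<s. mconst (c i) * h i) \<in> P \<Longrightarrow> i < s \<Longrightarrow> c i = 0"
    using \<open>indep_mod P s D'\<close> unfolding indep_mod_def by blast
  define F where "F = (\<lambda>i. if i < r then g i else f * h (i - r))"
  have "F i \<in> carrier (mpoly_ring E)" if "i < r + s" for i
    using that g(1) h(1) fc by (auto simp: F_def mpoly_ring_closed)
  moreover have "mdeg \<mu> \<le> max D (D' + k)" if "i < r + s" "\<mu> \<in> keys (F i)" for i \<mu>
  proof (cases "i < r")
    case True
    with that g(2)[of i \<mu>] show ?thesis by (simp add: F_def)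
  next
    case False
    with that have "\<mu> \<in> keys (f * h (i - r))" "i - r < s" by (auto simp: F_def)
    then have "mdeg \<mu> \<le> k + D'"
      using mdeg_keys_mult[of f k "h (i - r)" D' \<mu>] f(3) h(2)[of "i - r"] by blast
    then show ?thesis by simp
  qed
  moreover have "c i = 0" if c: "(\<Sum>i<r + s. mconst (c i) * F i) \<in> P" and i: "i < r + s" for c i
  proof -
    define X where "X = (\<Sum>i<r. mconst (c i) * g i)"
    define Y where "Y = (\<Sum>i<s. mconst (c (r + i)) * h i)"
    have sum: "(\<Sum>i<r + s. mconst (c i) * F i) = X + f * Y"
      unfolding sum_split_add X_def Y_def by (simp add: F_def sum_distrib_left mult.left_commute)
    have Yc: "Y \<in> carrier (mpoly_ring E)"
      unfolding Y_def by (intro mpoly_ring_sum_closed) (auto simp: mpoly_ring_closed mconst_closed h(1))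
    \<comment> \<open>Modulo \<open>Q\<close> the term \<open>f * Y\<close> vanishes, so the
      independence of the \<open>g i\<close> first kills the coefficients of
      \<open>X\<close>.\<close>
    have fQ: "f * y \<in> Q" if "y \<in> carrier (mpoly_ring E)" for y
      using Q.I_r_closed[OF f(1) that] by simp
    have XY: "X + f * Y \<in> Q"
      using c \<open>P \<subseteq> Q\<close> unfolding sum by blast
    have "X + f * Y + f * - Y \<in> Q"
      using additive_subgroup.a_closed[OF Q.is_additive_subgroup XY fQ[OF mpoly_ring_uminus_closed[OF Yc]]]
      by (simp only: mpoly_ring_simps)
    moreover have "X + f * Y + f * - Y = X" for X Y :: "('v set, 'k) mpoly"
      by (simp add: algebra_simps)
    ultimately have "X \<in> Q" by metis
    then have zero: "c i = 0" if "i < r" for i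
      using g(3)[of c i] that by (simp add: X_def)
    then have "X = 0"
      by (simp add: X_def mconst_0)
    with c have "f * Y \<in> P" by (simp add: sum)
    \<comment> \<open>Primality cancels \<open>f\<close>, which lies outside
      \<open>P\<close>.\<close>
    then have "Y \<in> P"
      using P.I_prime[OF fc Yc] f(2) by simp
    then have "c (r + i) = 0" if "i < s" for i
      using h(3)[of "\<lambda>i. c (r + i)" i] that by (simp add: Y_def)
    note zero' = this
    from zero'[of "i - r"] zero[of i] i show "c i = 0"
      by (cases "i < r") auto
  qed
  ultimately show ?thesis
    unfolding indep_mod_def by blast
qed

text \<open>Iterating the step multiplies the family for \<open>Q\<close> by the powers of
  \<open>f\<close> up to the exponent \<open>N\<close>.\<close>

lemma indep_mod_powers:
  assumes "primeideal P (mpoly_ring E)" "primeideal Q (mpoly_ring E)" "P \<subseteq> Q"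
    "f \<in> Q" "f \<notin> P" "\<forall>\<mu>\<in>keys f. mdeg \<mu> \<le> k" "indep_mod Q r D"
  shows "indep_mod P (r * Suc N) (D + N * k)"
proof (induction N)
  case 0
  show ?case
    using indep_mod_mono[OF assms(7,3)] by simp
next
  case (Suc N)
  have "max D (D + N * k + k) = D + Suc N * k" by simp
  with indep_mod_step[OF assms Suc] show ?case
    by (simp add: ac_simps)
qed

text \<open>Each strict inclusion contributes one element with exponents 0 to \<open>N\<close>,
  which gives \<open>Suc N ^ l\<close> products of degree linear in \<open>N\<close>: growth of
  order \<open>l\<close>.\<close>

lemma indep_mod_chain:
  assumes "\<And>i. i \<le> l \<Longrightarrow> primeideal (Q i) (mpoly_ring E)" "\<And>i. i < l \<Longrightarrow> Q i \<subset> Q (Suc i)"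
  shows "\<exists>K. \<forall>N. indep_mod (Q 0) (Suc N ^ l) (K * N)"
  using assms
proof (induction l arbitrary: Q)
  case 0
  interpret primeideal "Q 0" "mpoly_ring E" by (rule 0) simp
  have "c = 0" if c: "mconst c \<in> Q 0" for c
  proof (rule ccontr)
    assume "c \<noteq> 0"
    have "mconst (inverse c) * mconst c \<in> Q 0"
      using I_l_closed[OF c mconst_closed[of "inverse c"]] by simp
    then have "1 \<in> Q 0"
      using \<open>c \<noteq> 0\<close> by (simp add: mconst_mult[symmetric] mconst_1)
    then show False
      using I_notcarr one_imp_carrier by simp
  qed
  \<comment> \<open>A proper ideal contains no nonzero constant, so the single polynomial 1 is
    independent.\<close>
  then have "indep_mod (Q 0) 1 0"
    unfolding indep_mod_def by (intro exI[of _ "\<lambda>_. 1"]) (auto simp: one_closed_mpoly)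
  then show ?case
    by (intro exI[of _ 0]) simp
next
  case (Suc l)
  from Suc.prems Suc.IH[of "\<lambda>i. Q (Suc i)"] obtain K
    where K: "\<And>N. indep_mod (Q 1) (Suc N ^ l) (K * N)" by auto
  have P: "primeideal (Q 0) (mpoly_ring E)" "primeideal (Q 1) (mpoly_ring E)"
    using Suc.prems(1) by simp_all
  have sub: "Q 0 \<subset> Q 1" using Suc.prems(2)[of 0] by simp
  then obtain f where f: "f \<in> Q 1" "f \<notin> Q 0" by blast
  define k where "k = (\<Sum>\<mu>\<in>keys f. mdeg \<mu>)"
  have "\<forall>\<mu>\<in>keys f. mdeg \<mu> \<le> k"
    unfolding k_def by (auto intro: member_le_sum)
  then have step: "indep_mod (Q 0) (Suc N ^ l * Suc N) (K * N + N * k)" for N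
    by (rule indep_mod_powers[OF P psubset_imp_subset[OF sub] f _ K])
  have "indep_mod (Q 0) (Suc N ^ Suc l) ((K + k) * N)" for N
    using step[of N] by (simp only: power_Suc2 add_mult_distrib mult.commute[of N k])
  then show ?case by blast
qed

text \<open>As \<open>I\<close> is the kernel of \<open>edge_hom\<close>, the images of an
  independent family stay independent, and they lie in the span of the monomials attained in degree
  at most \<open>D\<close>.\<close>

lemma indep_mod_I_bound:
  assumes "indep_mod I r D"
  shows "r \<le> card (\<Union>d\<le>D. sums_of (edge_vec ` E) d)"
proof -
  interpret vs: vector_space "\<lambda>(c::'k) (p::('v, 'k) mpoly). mconst c * p"
    by (rule vector_space_mpoly)
  obtain f where f: "\<And>i. i < r \<Longrightarrow> f i \<in> carrier (mpoly_ring E)"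
      "\<And>i \<mu>. i < r \<Longrightarrow> \<mu> \<in> keys (f i) \<Longrightarrow> mdeg \<mu> \<le> D"
      "\<And>c i. (\<Sum>i<r. mconst (c i) * f i) \<in> I \<Longrightarrow> i < r \<Longrightarrow> c i = 0"
    using assms unfolding indep_mod_def by blast
  define M where "M = (\<Union>d\<le>D. sums_of (edge_vec ` E) d)"
  have finM: "finite M"
    using finite_E by (auto simp: M_def intro: finite_sums_of)
  have rel: "c i = 0" if "(\<Sum>i<r. mconst (c i) * edge_hom (f i)) = 0" "i < r" for c i
  proof (rule f(3)[OF _ that(2)])
    have "edge_hom (\<Sum>i<r. mconst (c i) * f i) = 0"
      using that(1) by (simp add: edge_hom_sum edge_hom_mult edge_hom_mconst)
    then show "(\<Sum>i<r. mconst (c i) * f i) \<in> I"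
      unfolding mem_I by (auto intro!: mpoly_ring_sum_closed simp: mpoly_ring_closed mconst_closed f(1))
  qed
  have inj: "inj_on (\<lambda>i. edge_hom (f i)) {..<r}"
  proof (rule inj_onI, rule ccontr)
    fix i j assume ij: "i \<in> {..<r}" "j \<in> {..<r}" "edge_hom (f i) = edge_hom (f j)" "i \<noteq> j"
    \<comment> \<open>Two equal images would satisfy the relation with coefficients 1 and -1; hence
      the indexed family can be treated as a set of size \<open>r\<close>.\<close>
    define c :: "nat \<Rightarrow> 'k" where "c = (\<lambda>a. if a = i then 1 else if a = j then -1 else 0)"
    have "(\<Sum>a<r. mconst (c a) * edge_hom (f a)) =
        (\<Sum>a<r. (if a = i then edge_hom (f i) else 0) + (if a = j then - edge_hom (f j) else 0))"
      using ij(4) by (intro sum.cong) (auto simp: c_def mconst_0 mconst_1 mconst_uminus)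
    also have "\<dots> = 0"
      using ij by (simp add: sum.distrib)
    finally have "c i = 0" using rel ij(1) by blast
    then show False by (simp add: c_def)
  qed
  let ?B = "(\<lambda>i. edge_hom (f i)) ` {..<r}" and ?T = "(\<lambda>\<mu>. single \<mu> (1::'k)) ` M"
  have indep: "vs.independent ?B"
  proof (rule vs.independent_if_scalars_zero)
    fix c :: "('v, 'k) mpoly \<Rightarrow> 'k" and x
    assume sum: "(\<Sum>x\<in>?B. mconst (c x) * x) = 0" and "x \<in> ?B"
    then obtain i where i: "i < r" "x = edge_hom (f i)" by auto
    have "(\<Sum>i<r. mconst (c (edge_hom (f i))) * edge_hom (f i)) = 0"
      using sum by (simp add: sum.reindex[OF inj])
    from rel[OF this i(1)] i(2) show "c x = 0" by simp
  qed simp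
  have span: "?B \<subseteq> vs.span ?T"
  proof
    fix x assume "x \<in> ?B"
    then obtain i where i: "i < r" "x = edge_hom (f i)" by auto
    have "\<mu> \<in> M" if \<mu>: "\<mu> \<in> keys x" for \<mu>
    proof -
      obtain \<nu> where \<nu>: "\<nu> \<in> keys (f i)" "\<mu> = edge_exp \<nu>"
        using \<mu> i keys_edge_hom[of "f i"] by blast
      then have "keys \<nu> \<subseteq> E" "mdeg \<nu> \<le> D"
        using f(1,2)[OF i(1)] by (auto simp: mem_mpoly_ring)
      then show ?thesis
        using edge_exp_image[of E "mdeg \<nu>"] \<nu>(2) by (auto simp: M_def)
    qed
    then have "mconst (lookup x \<mu>) * single \<mu> 1 \<in> vs.span ?T" if "\<mu> \<in> keys x" for \<mu>
      using that by (blast intro: vs.span_scale[OF vs.span_base])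
    then have "(\<Sum>\<mu>\<in>keys x. mconst (lookup x \<mu>) * single \<mu> 1) \<in> vs.span ?T"
      by (rule vs.span_sum)
    then show "x \<in> vs.span ?T"
      by (simp only: mconst_mult_single mult_1_right poly_mapping_sum_single)
  qed
  have "card ?B \<le> card ?T"
    using vs.independent_span_bound[OF finite_imageI[OF finM] indep span] by (rule conjunct2)
  also have "\<dots> \<le> card M"
    by (rule card_image_le[OF finM])
  finally show ?thesis
    by (simp add: card_image[OF inj] M_def)
qed

text \<open>The chain is pulled back to the polynomial ring, where it stays strict because
  \<open>cls\<close> is surjective. Its growth of order \<open>l\<close> then competes with the
  bound of order \<open>b\<close>.\<close>

lemma prime_chain_le:
  assumes chain: "prime_chain A l P"
    and card: "\<And>D. card (\<Union>d\<le>D. sums_of (edge_vec ` E) d) \<le> Suc D ^ b"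
  shows "l \<le> b"
proof (rule ccontr)
  assume "\<not> l \<le> b"
  define Q where "Q = (\<lambda>i. {p \<in> carrier (mpoly_ring E). cls p \<in> P i})"
  have P: "primeideal (P i) A" if "i \<le> l" for i
    using chain that by (simp add: prime_chain_def)
  have Q: "primeideal (Q i) (mpoly_ring E)" if "i \<le> l" for i
    unfolding Q_def by (rule proj.primeideal_vimage[OF cring_mpoly_ring P[OF that]])
  have "Q i \<subset> Q (Suc i)" if i: "i < l" for i
  proof -
    have "P i \<subset> P (Suc i)" using chain i by (simp add: prime_chain_def)
    moreover from this obtain X where X: "X \<in> P (Suc i)" "X \<notin> P i" by blast
    moreover have "P (Suc i) \<subseteq> carrier A"
      using P[of "Suc i"] i ideal.axioms(1) primeideal.axioms(1) additive_subgroup.a_subset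
      by (metis Suc_leI)
    then obtain p where "p \<in> carrier (mpoly_ring E)" "X = cls p"
      using X(1) carrier_A by blast
    ultimately show ?thesis unfolding Q_def by blast
  qed
  from indep_mod_chain[of l Q, OF Q this] obtain K where K: "\<And>N. indep_mod (Q 0) (Suc N ^ l) (K * N)"
    by blast
  have "I \<subseteq> Q 0"
  proof
    fix p assume "p \<in> I"
    then have "p \<in> carrier (mpoly_ring E)" "cls p = \<zero>\<^bsub>A\<^esub>"
      by (auto simp: mem_I cls_eq_zero_iff)
    moreover have "\<zero>\<^bsub>A\<^esub> \<in> P 0"
      using P[of 0] additive_subgroup.zero_closed ideal.axioms(1) primeideal.axioms(1) by blast
    ultimately show "p \<in> Q 0" by (simp add: Q_def)
  qed
  have bound: "Suc N ^ l \<le> Suc (K * N) ^ b" for N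
    using indep_mod_I_bound[OF indep_mod_mono[OF K \<open>I \<subseteq> Q 0\<close> order_refl]] card[of "K * N"]
    by (rule order_trans)
  \<comment> \<open>If \<open>l > b\<close>, this value is just large enough: the bound would give
    \<open>Suc N * Suc N ^ b \<le> N * Suc N ^ b\<close>.\<close>
  define N where "N = Suc K ^ b"
  have "Suc N * Suc N ^ b \<le> Suc N ^ l"
    using \<open>\<not> l \<le> b\<close> power_increasing[of "Suc b" l "Suc N"] by simp
  also have "\<dots> \<le> Suc (K * N) ^ b" by (rule bound)
  also have "\<dots> \<le> (Suc K * Suc N) ^ b" by (intro power_mono) auto
  also have "\<dots> = N * Suc N ^ b" by (simp only: power_mult_distrib N_def)
  finally show False by simp
qed

text \<open>
  The variables with index at most \<open>t\<close> are kept and renamed to naturals, for which the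
  polynomial ring is known to be a domain; the others are set to 0.
\<close>

definition face_hom :: "('v \<Rightarrow> nat) \<Rightarrow> nat \<Rightarrow> ('v set, 'k) mpoly \<Rightarrow> (nat, 'k) mpoly" where
  "face_hom idx t p = subst_mon (\<lambda>\<nu>. idx ` keys \<nu> \<subseteq> {..t}) (rename idx) (edge_hom p)"

lemma face_hom_add: "face_hom idx t (p + q) = face_hom idx t p + face_hom idx t q"
  and face_hom_mult: "face_hom idx t (p * q) = face_hom idx t p * face_hom idx t q"
  and face_hom_1: "face_hom idx t 1 = 1"
proof -
  show "face_hom idx t (p + q) = face_hom idx t p + face_hom idx t q"
    by (simp add: face_hom_def edge_hom_add subst_mon_add)
  show "face_hom idx t (p * q) = face_hom idx t p * face_hom idx t q"
    unfolding face_hom_def edge_hom_mult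
    by (rule subst_mon_mult) (auto simp: keys_mult_nat rename_add)
  show "face_hom idx t 1 = 1"
    using subst_mon_mconst[of "\<lambda>\<nu>. idx ` keys \<nu> \<subseteq> {..t}" "rename idx" 1]
    by (simp add: face_hom_def mconst_1 rename_def)
qed

text \<open>Killing more vertices factors through killing fewer, so the kernels grow as the
  threshold falls.\<close>

lemma face_hom_restrict:
  assumes "s \<le> t"
  shows "face_hom idx s p = subst_mon (\<lambda>\<nu>. keys \<nu> \<subseteq> {..s}) id (face_hom idx t p)"
proof -
  let ?q = "edge_hom p"
  have "face_hom idx s p = (\<Sum>\<mu>\<in>keys ?q. subst_mon (\<lambda>\<nu>. keys \<nu> \<subseteq> {..s}) id
      (if idx ` keys \<mu> \<subseteq> {..t} then single (rename idx \<mu>) (lookup ?q \<mu>) else 0))"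
    unfolding face_hom_def subst_mon_def[of _ "rename idx"]
    using assms by (intro sum.cong refl) (auto simp: keys_rename)
  then show ?thesis
    by (simp add: face_hom_def subst_mon_def[of _ "rename idx"] subst_mon_sum)
qed

lemma face_ideal_prime:
  "primeideal (cls ` {p \<in> carrier (mpoly_ring E). face_hom idx t p = 0}) A"
proof -
  let ?S = "mpoly_ring UNIV :: (nat, 'k) mpoly ring"
  interpret S: domain ?S by (rule domain_mpoly_ring)
  \<comment> \<open>The choice of representative is harmless because \<open>face_hom\<close> depends
    on \<open>p\<close> only through \<open>edge_hom p\<close>, which is constant on a
    class.\<close>
  define h where "h = (\<lambda>X. face_hom idx t (SOME p. p \<in> X))"
  have h: "h (cls p) = face_hom idx t p" if p: "p \<in> carrier (mpoly_ring E)" for p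
  proof -
    have "p \<in> cls p" using p by (simp add: cls_eq_set)
    then have "(SOME q. q \<in> cls p) \<in> cls p" by (rule someI)
    then have "edge_hom (SOME q. q \<in> cls p) = edge_hom p" using cls_eq_set[OF p] by blast
    then show ?thesis by (simp add: h_def face_hom_def)
  qed
  interpret h: ring_hom_ring A ?S h
  proof (rule ring_hom_ringI)
    show "ring A" by (rule quot.ring_axioms)
    show "ring ?S" by (rule S.ring_axioms)
    show "h x \<in> carrier ?S" for x by (simp add: mem_mpoly_ring)
    show "h \<one>\<^bsub>A\<^esub> = \<one>\<^bsub>?S\<^esub>"
      using h[OF one_closed_mpoly] by (simp add: cls_1 face_hom_1)
    fix x y assume "x \<in> carrier A" "y \<in> carrier A"
    then obtain p q where "p \<in> carrier (mpoly_ring E)" "q \<in> carrier (mpoly_ring E)" "x = cls p" "y = cls q"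
      using carrier_A by auto
    then show "h (x \<otimes>\<^bsub>A\<^esub> y) = h x \<otimes>\<^bsub>?S\<^esub> h y" "h (x \<oplus>\<^bsub>A\<^esub> y) = h x \<oplus>\<^bsub>?S\<^esub> h y"
      by (simp_all add: cls_mult cls_add h mpoly_ring_closed face_hom_add face_hom_mult)
  qed
  have "primeideal {X \<in> carrier A. h X \<in> {\<zero>\<^bsub>?S\<^esub>}} A"
    by (rule h.primeideal_vimage[OF cring_A S.zeroprimeideal])
  moreover have "{X \<in> carrier A. h X \<in> {\<zero>\<^bsub>?S\<^esub>}} = cls ` {p \<in> carrier (mpoly_ring E). face_hom idx t p = 0}"
    unfolding carrier_A by (auto simp: h)
  ultimately show ?thesis by simp
qed

text \<open>An edge whose largest index is \<open>t\<close> survives at threshold \<open>t\<close>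
  and dies at \<open>t - 1\<close>; its variable therefore separates consecutive kernels. The
  threshold \<open>l - k\<close> makes the chain increase.\<close>

lemma prime_chain_faces:
  assumes edges: "\<And>t. 1 \<le> t \<Longrightarrow> t \<le> l \<Longrightarrow> \<exists>e\<in>E. idx ` e \<subseteq> {..t} \<and> t \<in> idx ` e"
  shows "\<exists>P. prime_chain A l P"
proof -
  define P where "P = (\<lambda>k. cls ` {p \<in> carrier (mpoly_ring E). face_hom idx (l - k) p = 0})"
  have "P k \<subset> P (Suc k)" if k: "k < l" for k
  proof
    show "P k \<subseteq> P (Suc k)"
      using face_hom_restrict[of "l - Suc k" "l - k" idx] by (auto simp: P_def)
    have "1 \<le> l - k" "l - k \<le> l" using k by auto
    from edges[OF this] obtain e where e: "e \<in> E" "idx ` e \<subseteq> {..l - k}" "l - k \<in> idx ` e"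
      by blast
    then have "finite e"
      using graph by (metis simple_graph_def finite_subset)
    then have ke: "keys (edge_vec e) = e"
      by (simp add: edge_vec_def keys_sum_nat)
    let ?x = "single (single e 1) 1 :: ('v set, 'k) mpoly"
    have xc: "?x \<in> carrier (mpoly_ring E)"
      using e(1) by (simp add: mem_mpoly_ring)
    have fx: "face_hom idx t ?x = (if idx ` e \<subseteq> {..t} then single (rename idx (edge_vec e)) 1 else 0)" for t
      by (simp add: face_hom_def edge_hom_single edge_exp_single ke del: One_nat_def)
    have "\<not> idx ` e \<subseteq> {..l - Suc k}"
      using e(3) k by auto
    then have "cls ?x \<in> P (Suc k)"
      using xc fx[of "l - Suc k"] by (auto simp: P_def)
    moreover have "cls ?x \<notin> P k"
    proof
      assume "cls ?x \<in> P k"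
      then obtain p where p: "p \<in> carrier (mpoly_ring E)" "face_hom idx (l - k) p = 0" "cls ?x = cls p"
        by (auto simp: P_def)
      then have "face_hom idx (l - k) ?x = 0"
        using cls_eq_iff[OF xc p(1)] by (simp add: face_hom_def)
      then have "keys (single (rename idx (edge_vec e)) (1::'k)) = {}"
        using fx[of "l - k"] e(2) by simp
      then show False by simp
    qed
    ultimately show "P k \<noteq> P (Suc k)" by blast
  qed
  then have "prime_chain A l P"
    unfolding prime_chain_def P_def using face_ideal_prime by blast
  then show ?thesis by blast
qed

lemma krull_dim_eq:
  assumes "\<And>D. card (\<Union>d\<le>D. sums_of (edge_vec ` E) d) \<le> Suc D ^ b"
    and "\<And>t. 1 \<le> t \<Longrightarrow> t \<le> b \<Longrightarrow> \<exists>e\<in>E. idx ` e \<subseteq> {..t} \<and> t \<in> idx ` e"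
  shows "krull_dim A = enat b"
  unfolding krull_dim_def
proof (rule antisym)
  show "(SUP l\<in>{l. \<exists>P. prime_chain A l P}. enat l) \<le> enat b"
    using prime_chain_le[OF _ assms(1)] by (intro SUP_least) auto
  show "enat b \<le> (SUP l\<in>{l. \<exists>P. prime_chain A l P}. enat l)"
    using prime_chain_faces[OF assms(2)] by (intro SUP_upper) auto
qed

end


section \<open>Ferrers graphs\<close>

context ferrers_shape
begin

lemma sums_of_edge_mons_degrees:
  assumes "\<nu> \<in> sums_of (edge_mons 1 j) d"
  shows "(\<Sum>i = 1..n. lookup \<nu> (v i)) = d" "(\<Sum>l = 1..m. lookup \<nu> (u l)) = d"
    "x \<notin> v ` {1..n} \<union> u ` {1..m} \<Longrightarrow> lookup \<nu> x = 0"
proof -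
  have "(\<Sum>i = 1..n. lookup \<nu> (v i)) = d \<and> (\<Sum>l = 1..m. lookup \<nu> (u l)) = d \<and>
      (x \<notin> v ` {1..n} \<union> u ` {1..m} \<longrightarrow> lookup \<nu> x = 0)"
    using assms
  proof (induction d arbitrary: \<nu>)
    case (Suc d)
    then obtain a \<rho> where a: "a \<in> edge_mons 1 j" and \<rho>: "\<rho> \<in> sums_of (edge_mons 1 j) d" "\<nu> = a + \<rho>"
      by auto
    from a obtain k l where kl: "a = edge_mon k l" "1 \<le> k" "k \<le> n" "1 \<le> l" "l \<le> lam k"
      by (auto simp: edge_mons_def)
    have lm: "l \<le> m" using lam_bounds[of k] kl by auto
    have "(\<Sum>i = 1..n. lookup a (v i)) = (\<Sum>i = 1..n. if k = i then 1 else 0)"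
      using kl lookup_edge_mon_v by (intro sum.cong) auto
    then have A: "(\<Sum>i = 1..n. lookup a (v i)) = 1"
      using kl by simp
    have "(\<Sum>i = 1..m. lookup a (u i)) = (\<Sum>i = 1..m. if l = i then 1 else 0)"
      using kl lookup_edge_mon_u by (intro sum.cong) auto
    then have B: "(\<Sum>i = 1..m. lookup a (u i)) = 1"
      using kl lm by simp
    have C: "lookup a x = 0" if "x \<notin> v ` {1..n} \<union> u ` {1..m}"
    proof -
      have "v k \<noteq> x" "u l \<noteq> x" using that kl lm by auto
      then show ?thesis by (simp add: kl(1) edge_mon_def lookup_add lookup_single when_def)
    qed
    from Suc.IH[OF \<rho>(1)] A B C show ?case
      by (simp add: \<rho>(2) lookup_add sum.distrib del: One_nat_def)
  qed simp
  then show "(\<Sum>i = 1..n. lookup \<nu> (v i)) = d" "(\<Sum>l = 1..m. lookup \<nu> (u l)) = d"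
    "x \<notin> v ` {1..n} \<union> u ` {1..m} \<Longrightarrow> lookup \<nu> x = 0"
    by auto
qed

text \<open>
  The two vertex classes have the same degree sum, so one of the \<open>n + m\<close> exponents is redundant.
\<close>

lemma card_sums_of_edge_mons_le:
  "card (\<Union>d\<le>D. sums_of (edge_mons 1 j) d) \<le> Suc D ^ (n + m - 1)"
proof -
  let ?S = "\<Union>d\<le>D. sums_of (edge_mons 1 j) d" and ?V = "v ` {2..n} \<union> u ` {1..m}"
  let ?r = "\<lambda>\<nu>. restrict (lookup \<nu>) ?V"
  have "inj_on ?r ?S"
  proof (rule inj_onI)
    fix \<nu> \<rho> assume "\<nu> \<in> ?S" "\<rho> \<in> ?S" and eq: "?r \<nu> = ?r \<rho>"
    then obtain d e where \<nu>: "\<nu> \<in> sums_of (edge_mons 1 j) d" and \<rho>: "\<rho> \<in> sums_of (edge_mons 1 j) e"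
      by blast
    note dn = sums_of_edge_mons_degrees[OF \<nu>] and dr = sums_of_edge_mons_degrees[OF \<rho>]
    have on: "lookup \<nu> x = lookup \<rho> x" if "x \<in> ?V" for x
      using fun_cong[OF eq, of x] that by (simp only: restrict_apply if_True)
    have "(\<Sum>l = 1..m. lookup \<nu> (u l)) = (\<Sum>l = 1..m. lookup \<rho> (u l))"
      by (intro sum.cong refl on) auto
    then have "(\<Sum>i = 1..n. lookup \<nu> (v i)) = (\<Sum>i = 1..n. lookup \<rho> (v i))"
      using dn(1,2) dr(1,2) by simp
    moreover have "(\<Sum>i = 2..n. lookup \<nu> (v i)) = (\<Sum>i = 2..n. lookup \<rho> (v i))"
      by (intro sum.cong refl on) auto
    ultimately have v1: "lookup \<nu> (v 1) = lookup \<rho> (v 1)"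
      using n_pos by (simp add: sum.atLeast_Suc_atMost numeral_2_eq_2)
    show "\<nu> = \<rho>"
    proof (rule poly_mapping_eqI)
      fix x
      consider "x \<in> ?V" | "x = v 1" | "x \<notin> v ` {1..n} \<union> u ` {1..m}"
      proof -
        have "{1..n} = insert 1 {2..n}" using n_pos by auto
        then have "v ` {1..n} = insert (v 1) (v ` {2..n})" by simp
        then show ?thesis using that by blast
      qed
      then show "lookup \<nu> x = lookup \<rho> x"
      proof cases
        case 3
        then show ?thesis using dn(3)[OF 3] dr(3)[OF 3] by simp
      qed (use on v1 in auto)
    qed
  qed
  moreover have "?r ` ?S \<subseteq> ?V \<rightarrow>\<^sub>E {..D}"
  proof (rule image_subsetI)
    fix \<nu> assume "\<nu> \<in> ?S"
    then obtain d where d: "d \<le> D" and \<nu>: "\<nu> \<in> sums_of (edge_mons 1 j) d" by blast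
    note deg = sums_of_edge_mons_degrees(1,2)[OF \<nu>]
    have le_v: "lookup \<nu> (v i) \<le> d" if "i \<in> {1..n}" for i
      using member_le_sum[of i "{1..n}" "\<lambda>i. lookup \<nu> (v i)"] deg(1) that by simp
    have le_u: "lookup \<nu> (u l) \<le> d" if "l \<in> {1..m}" for l
      using member_le_sum[of l "{1..m}" "\<lambda>i. lookup \<nu> (u i)"] deg(2) that by simp
    have "lookup \<nu> x \<le> D" if "x \<in> ?V" for x
      using that
    proof
      assume "x \<in> v ` {2..n}"
      then obtain i where "x = v i" "i \<in> {1..n}" by auto
      with le_v d show ?thesis by (blast intro: order_trans)
    next
      assume "x \<in> u ` {1..m}"
      then obtain l where "x = u l" "l \<in> {1..m}" by auto
      with le_u d show ?thesis by (blast intro: order_trans)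
    qed
    then show "?r \<nu> \<in> ?V \<rightarrow>\<^sub>E {..D}" by (auto simp: PiE_def Pi_def)
  qed
  moreover have "finite (?V \<rightarrow>\<^sub>E {..D})"
    by (intro finite_PiE) auto
  ultimately have "card ?S \<le> card (?V \<rightarrow>\<^sub>E {..D})"
    by (metis card_inj_on_le)
  also have "\<dots> = Suc D ^ card ?V"
    by (simp add: card_PiE)
  also have "card ?V = n + m - 1"
  proof -
    have "v ` {2..n} \<subseteq> v ` {1..n}" by auto
    with disj have "v ` {2..n} \<inter> u ` {1..m} = {}" by blast
    moreover have "card (v ` {2..n}) = n - 1"
      by (subst card_image) (auto intro: inj_on_subset[OF inj_v])
    moreover have "card (u ` {1..m}) = m" using card_image[OF inj_u] by simp
    ultimately show ?thesis using n_pos by (simp add: card_Un_disjoint)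
  qed
  finally show ?thesis .
qed

section \<open>The degree as a minimum\<close>

lemma degree_h_rows_trivial:
  assumes "n = 1 \<or> lam 2 = 1"
  shows "degree (h_rows (n - 1) (lam 1)) = 0"
proof (rule degree_h_rows)
  fix k assume k: "k < lam 1 \<and> k < n \<and> (\<forall>q\<in>{1..k}. k + 2 \<le> lam (1 + q) + q)"
  show "k \<le> 0"
  proof (rule ccontr)
    assume "\<not> k \<le> 0"
    then have "1 \<in> {1..k}" by simp
    with k have "k + 2 \<le> lam (1 + 1) + 1" by blast
    with assms k \<open>\<not> k \<le> 0\<close> show False by (simp add: numeral_2_eq_2)
  qed
qed (use lam_bounds[of 1] n_pos in auto)

text \<open>With \<open>j = q + 1\<close> the support conditions become
  \<open>k \<le> lam j + j - 3\<close>. At \<open>j = s + 1\<close>, where the parts equal to 1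
  begin, this bound is \<open>s - 1\<close>.\<close>

lemma degree_h_rows_Min:
  assumes "2 \<le> n" "2 \<le> lam 2" and s: "s \<in> {1..n}" "2 \<le> lam s" "\<forall>i\<in>{s<..n}. lam i = 1"
  shows "int (degree (h_rows (n - 1) (lam 1))) =
    Min (insert (int s - 1) ((\<lambda>j. int (lam j) + int j - 3) ` {2..s}))" (is "_ = Min ?M")
proof -
  have "s \<noteq> 1"
    using s(3) assms(1,2) by force
  then have s2: "2 \<le> s" using s(1) by auto
  have lj: "2 \<le> lam j" if "j \<in> {2..s}" for j
    using lam_anti[of j s] that s by auto
  have fin: "finite ?M" by simp
  define D where "D = nat (Min ?M)"
  \<comment> \<open>Positivity of the minimum makes its conversion to a natural number
    faithful.\<close>
  have "1 \<le> x" if "x \<in> ?M" for x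
    using that
  proof (elim insertE imageE)
    fix j assume "x = int (lam j) + int j - 3" "j \<in> {2..s}"
    then show "1 \<le> x" using lj[of j] by auto
  qed (use s2 in simp)
  moreover have Min_mem: "Min ?M \<in> ?M"
    by (rule Min_in[OF fin]) simp
  ultimately have "1 \<le> Min ?M" by blast
  then have D: "int D = Min ?M"
    unfolding D_def by (intro nat_0_le) (rule order_trans[OF zero_le_one])
  have D_le: "int D \<le> x" if "x \<in> ?M" for x
    unfolding D using that fin by (rule Min_le[rotated])
  have Ds: "D + 1 \<le> s"
    using D_le[of "int s - 1"] by auto
  have Dj: "D + 3 \<le> lam j + j" if "j \<in> {2..s}" for j
    using D_le[of "int (lam j) + int j - 3"] that by auto
  have "degree (h_rows (n - 1) (lam 1)) = D"
  proof (rule degree_h_rows)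
    fix k assume k: "k < lam 1 \<and> k < n \<and> (\<forall>q\<in>{1..k}. k + 2 \<le> lam (1 + q) + q)"
    \<comment> \<open>Otherwise \<open>q = s\<close> would be admissible, and
      \<open>lam (1 + s) = 1\<close> would force \<open>k + 2 \<le> s + 1\<close>.\<close>
    have "k < s"
    proof (rule ccontr)
      assume "\<not> k < s"
      then have "k + 2 \<le> lam (1 + s) + s" "1 + s \<in> {s<..n}" using k s2 by auto
      with s(3) \<open>\<not> k < s\<close> show False by force
    qed
    moreover have "k + 3 \<le> lam j + j" if j: "j \<in> {2..s}" for j
    proof (cases "j - 1 \<le> k")
      case True
      then have "j - 1 \<in> {1..k}" using j by auto
      with k have "k + 2 \<le> lam (1 + (j - 1)) + (j - 1)" by blast
      then show ?thesis using j by auto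
    next
      \<comment> \<open>Here \<open>j\<close> exceeds \<open>k + 1\<close>, and the inequality
        follows from \<open>2 \<le> lam j\<close>.\<close>
      case False
      then show ?thesis using lj[OF j] by auto
    qed
    ultimately have "int k \<le> x" if "x \<in> ?M" for x
      using that
    proof (elim insertE imageE)
      fix j assume "x = int (lam j) + int j - 3" "j \<in> {2..s}"
      moreover assume "\<And>j. j \<in> {2..s} \<Longrightarrow> k + 3 \<le> lam j + j"
      ultimately show "int k \<le> x" by force
    qed simp
    then have "int k \<le> int D"
      unfolding D using Min_mem by blast
    then show "k \<le> D" by simp
  next
    \<comment> \<open>The term \<open>j = 2\<close> of the minimum gives
      \<open>D \<le> lam 2 - 1\<close>.\<close>
    show "D < lam 1"
      using Dj[of 2] s2 lam_anti[of 1 2] assms(1) by auto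
    show "D < n" using Ds s(1) by auto
    show "\<forall>q\<in>{1..D}. D + 2 \<le> lam (1 + q) + q"
    proof
      fix q assume "q \<in> {1..D}"
      then show "D + 2 \<le> lam (1 + q) + q"
        using Dj[of "1 + q"] Ds by auto
    qed
  qed
  with D show ?thesis by simp
qed

end

section \<open>From the graph to its shape\<close>

locale ferrers_toric =
  fixes V :: "'v set" and E :: "'v set set" and v u :: "nat \<Rightarrow> 'v"
    and n m :: nat and lam :: "nat \<Rightarrow> nat" and I :: "('v set, 'k::field) mpoly set"
  assumes ferrers: "ferrers_graph V E n m v u"
    and lam: "\<forall>i\<in>{1..n}. lam i = vdeg E (v i)"
    and I: "I = toric_ideal V E"
begin

lemma
  shows ferrers_simple: "simple_graph V E"
    and ferrers_inj: "inj_on v {1..n}" "inj_on u {1..m}"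
    and ferrers_disj: "v ` {1..n} \<inter> u ` {1..m} = {}"
    and ferrers_pos: "1 \<le> n" "1 \<le> m"
    and ferrers_edge: "e \<in> E \<Longrightarrow> \<exists>i\<in>{1..n}. \<exists>j\<in>{1..m}. e = {v i, u j}"
    and ferrers_corners: "{v 1, u m} \<in> E" "{v n, u 1} \<in> E"
    and ferrers_down: "{v i, u j} \<in> E \<Longrightarrow> i \<in> {1..n} \<Longrightarrow> j \<in> {1..m} \<Longrightarrow>
      k \<in> {1..i} \<Longrightarrow> l \<in> {1..j} \<Longrightarrow> {v k, u l} \<in> E"
  using ferrers unfolding ferrers_graph_def by blast+

lemma vertices_distinct:
  assumes "i \<in> {1..n}" "j \<in> {1..m}"
  shows "v i \<noteq> u j"
  using ferrers_disj assms by (metis disjoint_iff imageI)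

lemma doubleton_eq:
  assumes "i \<in> {1..n}" "j \<in> {1..m}" "i' \<in> {1..n}" "j' \<in> {1..m}"
  shows "{v i, u j} = {v i', u j'} \<longleftrightarrow> i = i' \<and> j = j'"
  using vertices_distinct[OF assms(1,4)] vertices_distinct[OF assms(3,2)]
    inj_on_eq_iff[OF ferrers_inj(1) assms(1,3)] inj_on_eq_iff[OF ferrers_inj(2) assms(2,4)]
  by (simp add: doubleton_eq_iff)

text \<open>The neighbours of \<open>v i\<close> form an initial segment of the columns, which is
  determined by its size, the degree of \<open>v i\<close>.\<close>

lemma edge_iff:
  assumes i: "i \<in> {1..n}" and j: "j \<in> {1..m}"
  shows "{v i, u j} \<in> E \<longleftrightarrow> j \<le> lam i"
proof -
  define J where "J = {j \<in> {1..m}. {v i, u j} \<in> E}"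
  have "{e \<in> E. v i \<in> e} = (\<lambda>j. {v i, u j}) ` J"
  proof (intro equalityI subsetI)
    fix e assume e: "e \<in> {e \<in> E. v i \<in> e}"
    then obtain i' j' where ij: "i' \<in> {1..n}" "j' \<in> {1..m}" "e = {v i', u j'}"
      using ferrers_edge[of e] by blast
    with e have "v i = v i'"
      using vertices_distinct[OF i ij(2)] by auto
    with ij e show "e \<in> (\<lambda>j. {v i, u j}) ` J"
      by (auto simp: J_def)
  qed (auto simp: J_def)
  moreover have "inj_on (\<lambda>j. {v i, u j}) J"
    using doubleton_eq[OF i _ i] by (auto simp: inj_on_def J_def)
  ultimately have card: "lam i = card J"
    using lam i by (simp add: vdeg_def card_image)
  have "J = {1..lam i}"
  proof (cases "J = {}")
    case True
    then show ?thesis using card by simp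
  next
    case False
    have fin: "finite J" by (simp add: J_def)
    have "Max J \<in> J" using fin False by (rule Max_in)
    have "J = {1..Max J}"
    proof (intro equalityI subsetI)
      fix l assume "l \<in> {1..Max J}"
      then show "l \<in> J"
        using \<open>Max J \<in> J\<close> ferrers_down[of i "Max J" i l] i by (auto simp: J_def)
    qed (use fin in \<open>auto simp: J_def\<close>)
    then have "card J = Max J" by (metis card_atLeastAtMost diff_Suc_1)
    with \<open>J = {1..Max J}\<close> card show ?thesis by simp
  qed
  then have "j \<in> J \<longleftrightarrow> j \<in> {1..lam i}" by simp
  with j show ?thesis by (auto simp: J_def)
qed

lemma lam_le:
  assumes "i \<in> {1..n}"
  shows "1 \<le> lam i" "lam i \<le> m"
proof -
  have "{v i, u 1} \<in> E"
    using ferrers_down[OF ferrers_corners(2), of i 1] assms ferrers_pos by auto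
  then show "1 \<le> lam i"
    using edge_iff[OF assms, of 1] ferrers_pos by auto
  have "{e \<in> E. v i \<in> e} \<subseteq> (\<lambda>j. {v i, u j}) ` {1..m}"
  proof
    fix e assume e: "e \<in> {e \<in> E. v i \<in> e}"
    then obtain i' j' where ij: "i' \<in> {1..n}" "j' \<in> {1..m}" "e = {v i', u j'}"
      using ferrers_edge[of e] by blast
    with e have "v i = v i'"
      using vertices_distinct[OF assms ij(2)] by auto
    with ij show "e \<in> (\<lambda>j. {v i, u j}) ` {1..m}" by auto
  qed
  then have "card {e \<in> E. v i \<in> e} \<le> card {1..m}"
    by (rule surj_card_le[rotated]) simp
  then show "lam i \<le> m"
    using lam assms by (simp add: vdeg_def)
qed

lemma lam_1: "lam 1 = m"
  using edge_iff[of 1 m] lam_le[of 1] ferrers_corners(1) ferrers_pos by auto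

sublocale shape: ferrers_shape n m lam v u
proof
  fix i k assume ik: "1 \<le> i" "i \<le> k" "k \<le> n"
  then have k: "k \<in> {1..n}" by auto
  have "{v k, u (lam k)} \<in> E"
    using edge_iff[OF k, of "lam k"] lam_le[OF k] by auto
  then have "{v i, u (lam k)} \<in> E"
    using ferrers_down[of k "lam k" i "lam k"] lam_le[OF k] ik by auto
  then show "lam k \<le> lam i"
    using edge_iff[of i "lam k"] lam_le[OF k] ik by auto
qed (use ferrers_pos ferrers_inj ferrers_disj lam_le in auto)

sublocale toric_ring V E I
  by unfold_locales (rule ferrers_simple, rule I)

lemma edge_vec_eq:
  assumes "i \<in> {1..n}" "j \<in> {1..m}"
  shows "edge_vec {v i, u j} = shape.edge_mon i j"
  using vertices_distinct[OF assms] by (simp add: edge_vec_def shape.edge_mon_def)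

lemma edge_vec_image: "edge_vec ` E = shape.edge_mons 1 (lam 1)"
proof (intro equalityI subsetI)
  fix a assume "a \<in> edge_vec ` E"
  then obtain i j where ij: "i \<in> {1..n}" "j \<in> {1..m}" "{v i, u j} \<in> E" "a = edge_vec {v i, u j}"
    using ferrers_edge by blast
  then show "a \<in> shape.edge_mons 1 (lam 1)"
    unfolding shape.edge_mons_def using edge_vec_eq edge_iff lam_1 by auto
next
  fix a assume "a \<in> shape.edge_mons 1 (lam 1)"
  then obtain i j where ij: "i \<in> {1..n}" "1 \<le> j" "j \<le> lam i" "a = shape.edge_mon i j"
    by (auto simp: shape.edge_mons_def)
  then have j: "j \<in> {1..m}" using lam_le[of i] by auto
  with ij show "a \<in> edge_vec ` E"
    using edge_iff[of i j] edge_vec_eq[OF ij(1) j] by (metis imageI)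
qed

text \<open>The order \<open>v 1\<close>, then \<open>u 1\<close> to \<open>u m\<close>, then
  \<open>v 2\<close> to \<open>v n\<close> joins every vertex after the first to an earlier one: the
  \<open>u j\<close> to \<open>v 1\<close>, and the later \<open>v i\<close> to
  \<open>u 1\<close>.\<close>

lemma krull_dim_ferrers: "krull_dim A = enat (n + m - 1)"
proof -
  define idx where "idx = (\<lambda>x. if x \<in> u ` {1..m} then the_inv_into {1..m} u x
    else if x = v 1 then 0 else m + the_inv_into {1..n} v x - 1)"
  have idx_u: "idx (u j) = j" if "j \<in> {1..m}" for j
    using that the_inv_into_f_f[OF ferrers_inj(2)] by (simp add: idx_def)
  have idx_v: "idx (v i) = (if i = 1 then 0 else m + i - 1)" if i: "i \<in> {1..n}" for i
  proof -
    have "v i \<notin> u ` {1..m}" using ferrers_disj i by blast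
    moreover have "v i = v 1 \<longleftrightarrow> i = 1"
      using inj_on_eq_iff[OF ferrers_inj(1) i] ferrers_pos by simp
    ultimately show ?thesis
      using the_inv_into_f_f[OF ferrers_inj(1) i] by (simp add: idx_def)
  qed
  show ?thesis
  proof (rule krull_dim_eq)
    show "card (\<Union>d\<le>D. sums_of (edge_vec ` E) d) \<le> Suc D ^ (n + m - 1)" for D
      unfolding edge_vec_image by (rule shape.card_sums_of_edge_mons_le)
    fix t assume t: "1 \<le> t" "t \<le> n + m - 1"
    show "\<exists>e\<in>E. idx ` e \<subseteq> {..t} \<and> t \<in> idx ` e"
    proof (cases "t \<le> m")
      case True
      then have "{v 1, u t} \<in> E"
        using ferrers_down[OF ferrers_corners(1), of 1 t] t ferrers_pos by auto
      then show ?thesis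
        using idx_u[of t] idx_v[of 1] True t ferrers_pos by (intro bexI[of _ "{v 1, u t}"]) auto
    next
      case False
      define i where "i = t + 1 - m"
      have i: "i \<in> {1..n}" "i \<noteq> 1" "t = m + i - 1" using False t by (auto simp: i_def)
      then have "{v i, u 1} \<in> E"
        using ferrers_down[OF ferrers_corners(2), of i 1] ferrers_pos by auto
      then show ?thesis
        using idx_u[of 1] idx_v[of i] i False ferrers_pos by (intro bexI[of _ "{v i, u 1}"]) auto
    qed
  qed
qed

text \<open>For the whole graph the exponent \<open>r + j\<close> is \<open>(n - 1) + m\<close>, the
  Krull dimension, so \<open>h_rows\<close> is the required numerator without further
  cancellation.\<close>

lemma h_poly_ferrers: "h_poly A (quot_field E I) (quot_part E I) = shape.h_rows (n - 1) (lam 1)"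
proof -
  have "hilbert_series A (quot_field E I) (quot_part E I) = shape.count_fps 1 (lam 1)"
    by (simp add: hilbert_series_def hilbert_fun_eq shape.count_fps_def shape.count_def edge_vec_image)
  moreover have "shape.count_fps 1 (lam 1) * (1 - fps_X) ^ (n + m - 1)
      = fps_of_poly (shape.h_rows (n - 1) (lam 1))"
    using shape.count_fps_h_rows[of "n - 1" "lam 1"] lam_le[of 1] lam_1 ferrers_pos by simp
  ultimately show ?thesis
    unfolding h_poly_def krull_dim_ferrers the_enat.simps
    by (intro the_equality) (simp_all add: fps_of_poly_eq_iff)
qed

lemma a_invariant_ferrers:
  "a_invariant A (quot_field E I) (quot_part E I) =
    int (degree (shape.h_rows (n - 1) (lam 1))) - (int n + int m - 1)"
  unfolding a_invariant_def h_poly_ferrers krull_dim_ferrers the_enat.simps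
  using ferrers_pos by simp

lemma graded_multiplicity_ferrers:
  "graded_multiplicity A (quot_field E I) (quot_part E I) = int (iterated_sum lam n)"
  unfolding graded_multiplicity_def h_poly_ferrers by (rule shape.h_rows_at_1)

end

theorem corollary6p17:
  fixes V :: "'v set" and E :: "'v set set" and v u :: "nat \<Rightarrow> 'v"
    and n m s :: nat and lam :: "nat \<Rightarrow> nat"
    and R :: "('v set, 'k::{alg_closed_field, field_char_0}) mpoly ring"
    and I :: "('v set, 'k) mpoly set"
  assumes ferrers: "ferrers_graph V E n m v u"
    and lam: "\<forall>i\<in>{1..n}. lam i = vdeg E (v i)"
    and R: "R = mpoly_ring E"
    and I: "I = toric_ideal V E"
    and s: "2 \<le> n \<and> 2 \<le> lam 2 \<longrightarrow>
      s \<in> {1..n} \<and> 2 \<le> lam s \<and> (\<forall>i\<in>{s<..n}. lam i = 1)"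
  shows "(n = 1 \<or> lam 2 = 1 \<longrightarrow>
           a_invariant (R Quot I) (quot_field E I) (quot_part E I) = - (int n + int m - 1))
       \<and> (\<not> (n = 1 \<or> lam 2 = 1) \<longrightarrow>
           a_invariant (R Quot I) (quot_field E I) (quot_part E I) =
             - (int n + int m - 1) +
             Min (insert (int s - 1) ((\<lambda>j. int (lam j) + int j - 3) ` {2..s})))
       \<and> graded_multiplicity (R Quot I) (quot_field E I) (quot_part E I) = int (iterated_sum lam n)"
proof -
  interpret ferrers_toric V E v u n m lam I
    using ferrers lam I by unfold_locales
  have "a_invariant (R Quot I) (quot_field E I) (quot_part E I) = - (int n + int m - 1)"
    if "n = 1 \<or> lam 2 = 1"
    using shape.degree_h_rows_trivial[OF that] unfolding R a_invariant_ferrers by simp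
  moreover have "a_invariant (R Quot I) (quot_field E I) (quot_part E I) =
      - (int n + int m - 1) + Min (insert (int s - 1) ((\<lambda>j. int (lam j) + int j - 3) ` {2..s}))"
    if neg: "\<not> (n = 1 \<or> lam 2 = 1)"
  proof -
    have "2 \<le> n" "2 \<le> lam 2"
      using neg ferrers_pos lam_le(1)[of 2] by auto
    with s show ?thesis
      using shape.degree_h_rows_Min[of s] unfolding R a_invariant_ferrers by simp
  qed
  ultimately show ?thesis
    unfolding R graded_multiplicity_ferrers by blast
qed

end
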